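(* Let $\mathscr{A}$ be a unital $C^*$-algebra equipped with a $*$-conjugate-automorphism $\sharp$, let $\mathscr{E}$ be a right Hilbert $\mathscr{A}$-module admitting a $\sharp$-conjugation $C$, and let $T\in\mathbb{L}(\mathscr{E})$ be such that $\overline{\operatorname{ran}(T)}$ is orthogonally complemented. Then the following assertions are equivalent. (i) $T$ is $C$-hyponormal, that is, $T^*T\geq CTT^*C$. (ii) $\|Tx\|\geq\|T^*Cx\|$ for every $x\in\mathscr{E}$.
   Context: A $*$-conjugate-automorphism on a $C^*$-algebra $\mathscr{A}$ is a map $\sharp:\mathscr{A}\to\mathscr{A}$, $a\mapsto a^\sharp$, such that for all $a,b\in\mathscr{A}$, $\lambda\in\mathbb{C}$: (1) $(\lambda a+b)^\sharp=\bar\lambda a^\sharp+b^\sharp$; (2) $(a^\sharp)^\sharp=a$; (3) $(a^\sharp)^*=(a^* )^\sharp$; (4) $(ab)^\sharp=a^\sharp b^\sharp$. $\mathbb{L}(\mathscr{E})$ is the $C^*$-algebra of adjointable linear operators on $\mathscr{E}$ (inner products are conjugate-linear in the first variable). A $\sharp$-conjugation on $\mathscr{E}$ is a bounded conjugate-linear operator $C:\mathscr{E}\to\mathscr{E}$ with $C^2=I_{\mathscr{E}}$ and $\langle Cx,Cy\rangle=\langle x,y\rangle^\sharp$ for all $x,y\in\mathscr{E}$. A closed submodule $M$ is orthogonally complemented if $\mathscr{E}=M\oplus M^\perp$. *)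

theory Defs
  imports "HOL-Analysis.Analysis"
begin

section \<open>Complex Banach spaces and unital C*-algebras\<close>

class complex_banach = banach +
  fixes scaleC :: "complex \<Rightarrow> 'a \<Rightarrow> 'a"  (infixr "*\<^sub>C" 75)
  assumes scaleC_add_right: "c *\<^sub>C (x + y) = c *\<^sub>C x + c *\<^sub>C y"
    and scaleC_add_left: "(c + d) *\<^sub>C x = c *\<^sub>C x + d *\<^sub>C x"
    and scaleC_scaleC: "c *\<^sub>C (d *\<^sub>C x) = (c * d) *\<^sub>C x"
    and scaleR_scaleC: "r *\<^sub>R x = complex_of_real r *\<^sub>C x"
    and norm_scaleC: "norm (c *\<^sub>C x) = cmod c * norm x"

text \<open>The unit comes from \<^class>\<open>monoid_mult\<close> rather than from \<^class>\<open>real_normed_algebra_1\<close>, so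
  that the zero algebra is not excluded; in a nonzero algebra \<open>norm 1 = 1\<close> follows from the
  C*-identity.\<close>

class unital_cstar_algebra = complex_banach + real_normed_algebra + monoid_mult +
  fixes star :: "'a \<Rightarrow> 'a"
  assumes mult_scaleC_left: "(c *\<^sub>C a) * b = c *\<^sub>C (a * b)"
    and mult_scaleC_right: "a * (c *\<^sub>C b) = c *\<^sub>C (a * b)"
    and star_add: "star (a + b) = star a + star b"
    and star_scaleC: "star (c *\<^sub>C a) = cnj c *\<^sub>C star a"
    and star_mult: "star (a * b) = star b * star a"
    and star_star: "star (star a) = a"
    and cstar_identity: "norm (star a * a) = (norm a)\<^sup>2"

definition cstar_spectrum :: "'a::unital_cstar_algebra \<Rightarrow> complex set" where
  "cstar_spectrum a =
     {c. \<not> (\<exists>b. (a - c *\<^sub>C 1) * b = 1 \<and> b * (a - c *\<^sub>C 1) = 1)}"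

definition cstar_positive :: "'a::unital_cstar_algebra \<Rightarrow> bool" where
  "cstar_positive a \<longleftrightarrow> star a = a \<and> cstar_spectrum a \<subseteq> \<real>\<^sub>\<ge>\<^sub>0"

definition star_conjugate_automorphism :: "('a::unital_cstar_algebra \<Rightarrow> 'a) \<Rightarrow> bool" where
  "star_conjugate_automorphism sharp \<longleftrightarrow>
     (\<forall>c a b. sharp (c *\<^sub>C a + b) = cnj c *\<^sub>C sharp a + sharp b) \<and>
     (\<forall>a. sharp (sharp a) = a) \<and>
     (\<forall>a. star (sharp a) = sharp (star a)) \<and>
     (\<forall>a b. sharp (a * b) = sharp a * sharp b)"

section \<open>Right Hilbert modules\<close>

text \<open>\<open>act x a\<close> is the right action \<open>x a\<close>, and \<open>ip\<close> is the inner product with values in the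
  algebra, conjugate-linear in the first variable. The norm of the type \<open>'e\<close> is required to be
  the one induced by \<open>ip\<close>; it is complete because \<^class>\<open>complex_banach\<close> extends
  \<^class>\<open>banach\<close>.\<close>

locale hilbert_cstar_module =
  fixes act :: "'e::complex_banach \<Rightarrow> 'a::unital_cstar_algebra \<Rightarrow> 'e"
    and ip :: "'e \<Rightarrow> 'e \<Rightarrow> 'a"
  assumes act_add_left: "act (x + y) a = act x a + act y a"
    and act_add_right: "act x (a + b) = act x a + act x b"
    and act_mult: "act x (a * b) = act (act x a) b"
    and act_one: "act x 1 = x"
    and act_scaleC_left: "act (c *\<^sub>C x) a = c *\<^sub>C act x a"
    and act_scaleC_right: "act x (c *\<^sub>C a) = c *\<^sub>C act x a"
    and ip_add_right: "ip x (y + z) = ip x y + ip x z"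
    and ip_scaleC_right: "ip x (c *\<^sub>C y) = c *\<^sub>C ip x y"
    and ip_act_right: "ip x (act y a) = ip x y * a"
    and ip_star: "star (ip x y) = ip y x"
    and ip_positive: "cstar_positive (ip x x)"
    and ip_definite: "ip x x = 0 \<Longrightarrow> x = 0"
    and norm_eq_ip: "norm x = sqrt (norm (ip x x))"

section \<open>The C*-algebra of adjointable operators\<close>

text \<open>As usual, linearity (over the complex numbers and over the algebra) and boundedness are not
  part of the definition of adjointability, since they follow from it; for linearity see
  \<open>adjointable_linear\<close> below.\<close>

definition adjointable :: "('e \<Rightarrow> 'e \<Rightarrow> 'a) \<Rightarrow> ('e \<Rightarrow> 'e) set" where
  "adjointable ip = {T. \<exists>S. \<forall>x y. ip (T x) y = ip x (S y)}"

definition adj :: "('e \<Rightarrow> 'e \<Rightarrow> 'a) \<Rightarrow> ('e \<Rightarrow> 'e) \<Rightarrow> 'e \<Rightarrow> 'e" where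
  "adj ip T = (THE S. \<forall>x y. ip (T x) y = ip x (S y))"

definition op_spectrum ::
  "('e::complex_banach \<Rightarrow> 'e \<Rightarrow> 'a) \<Rightarrow> ('e \<Rightarrow> 'e) \<Rightarrow> complex set" where
  "op_spectrum ip T =
     {c. \<not> (\<exists>S\<in>adjointable ip. (\<lambda>x. T x - c *\<^sub>C x) \<circ> S = id \<and> S \<circ> (\<lambda>x. T x - c *\<^sub>C x) = id)}"

definition op_positive :: "('e::complex_banach \<Rightarrow> 'e \<Rightarrow> 'a) \<Rightarrow> ('e \<Rightarrow> 'e) \<Rightarrow> bool" where
  "op_positive ip T \<longleftrightarrow>
     T \<in> adjointable ip \<and> adj ip T = T \<and> op_spectrum ip T \<subseteq> \<real>\<^sub>\<ge>\<^sub>0"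

definition op_le ::
  "('e::complex_banach \<Rightarrow> 'e \<Rightarrow> 'a) \<Rightarrow> ('e \<Rightarrow> 'e) \<Rightarrow> ('e \<Rightarrow> 'e) \<Rightarrow> bool" where
  "op_le ip S T \<longleftrightarrow>
     S \<in> adjointable ip \<and> T \<in> adjointable ip \<and> op_positive ip (\<lambda>x. T x - S x)"

context hilbert_cstar_module
begin

lemma ip_add_left: "ip (x + y) z = ip x z + ip y z"
  by (metis ip_add_right ip_star star_add)

lemma ip_scaleC_left: "ip (c *\<^sub>C x) y = cnj c *\<^sub>C ip x y"
  by (metis ip_scaleC_right ip_star star_scaleC)

lemma ip_act_left: "ip (act x a) y = star a * ip x y"
  by (metis ip_act_right ip_star star_mult)

lemma ip_eqI:
  assumes "\<And>z. ip z x = ip z y"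
  shows "x = y"
proof -
  have "ip z x = ip z (x - y) + ip z y" for z
    using ip_add_right[of z "x - y" y] by simp
  then have "ip (x - y) (x - y) = 0"
    using assms by (metis add_cancel_left_left)
  then show ?thesis
    using ip_definite by fastforce
qed

lemma adj_eqI:
  assumes "\<And>x y. ip (T x) y = ip x (S y)"
  shows "adj ip T = S"
  unfolding adj_def
proof (rule the_equality)
  fix S' assume "\<forall>x y. ip (T x) y = ip x (S' y)"
  then show "S' = S"
    using assms by (intro ext ip_eqI) metis
qed (use assms in blast)

lemma ip_adj:
  assumes "T \<in> adjointable ip"
  shows "ip (T x) y = ip x (adj ip T y)"
  using assms adj_eqI unfolding adjointable_def by blast

lemma adjointable_linear:
  assumes "T \<in> adjointable ip"
  shows "T (x + y) = T x + T y" and "T (c *\<^sub>C x) = c *\<^sub>C T x" and "T (act x a) = act (T x) a"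
proof -
  have *: "ip z (T w) = ip (adj ip T z) w" for z w
    using ip_adj[OF assms] by (metis ip_star)
  show "T (x + y) = T x + T y"
    by (rule ip_eqI) (simp add: * ip_add_right)
  show "T (c *\<^sub>C x) = c *\<^sub>C T x"
    by (rule ip_eqI) (simp add: * ip_scaleC_right)
  show "T (act x a) = act (T x) a"
    by (rule ip_eqI) (simp add: * ip_act_right)
qed

end

section \<open>Complemented submodules, conjugations and hyponormality\<close>

definition orth_compl :: "('e \<Rightarrow> 'e \<Rightarrow> 'a::zero) \<Rightarrow> 'e set \<Rightarrow> 'e set" where
  "orth_compl ip M = {y. \<forall>x\<in>M. ip x y = 0}"

definition orthogonally_complemented ::
  "('e::complex_banach \<Rightarrow> 'e \<Rightarrow> 'a::zero) \<Rightarrow> 'e set \<Rightarrow> bool" where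
  "orthogonally_complemented ip M \<longleftrightarrow>
     {x + y | x y. x \<in> M \<and> y \<in> orth_compl ip M} = UNIV \<and> M \<inter> orth_compl ip M = {0}"

definition sharp_conjugation ::
  "('e::complex_banach \<Rightarrow> 'e \<Rightarrow> 'a) \<Rightarrow> ('a \<Rightarrow> 'a) \<Rightarrow> ('e \<Rightarrow> 'e) \<Rightarrow> bool" where
  "sharp_conjugation ip sharp C \<longleftrightarrow>
     bounded_linear C \<and> (\<forall>c x. C (c *\<^sub>C x) = cnj c *\<^sub>C C x) \<and>
     C \<circ> C = id \<and> (\<forall>x y. ip (C x) (C y) = sharp (ip x y))"

definition C_hyponormal ::
  "('e::complex_banach \<Rightarrow> 'e \<Rightarrow> 'a) \<Rightarrow> ('e \<Rightarrow> 'e) \<Rightarrow> ('e \<Rightarrow> 'e) \<Rightarrow> bool" where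
  "C_hyponormal ip C T \<longleftrightarrow> op_le ip (C \<circ> T \<circ> adj ip T \<circ> C) (adj ip T \<circ> T)"

end

theory Submission
  imports Defs
begin

text \<open>Since \<open>C\<close> is isometric and \<open>S = C T\<^sup>* C\<close> is adjointable with adjoint \<open>C T C\<close>, the claim is that
  \<open>S\<^sup>* S \<le> T\<^sup>* T\<close> holds iff \<open>norm (S x) \<le> norm (T x)\<close> for all \<open>x\<close>. For a self-adjoint operator \<open>P\<close>,
  positivity of the spectrum is equivalent to positivity of the form \<open>\<langle>x, P x\<rangle>\<close>, so the operator
  inequality says \<open>\<langle>S x, S x\<rangle> \<le> \<langle>T x, T x\<rangle>\<close> in the algebra. This implies the inequality of norms;
  conversely, the inequality of norms at all vectors \<open>x a\<close> gives
  \<open>norm (a\<^sup>* \<langle>S x, S x\<rangle> a) \<le> norm (a\<^sup>* \<langle>T x, T x\<rangle> a)\<close>, and \<open>a = (\<langle>T x, T x\<rangle> + \<epsilon>)\<^sup>-\<^sup>1\<^sup>/\<^sup>2\<close> recovers the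
  order relation.\<close>

section \<open>Positivity in unital C*-algebras\<close>

lemma scaleC_zero_right [simp]: "c *\<^sub>C (0::'b::complex_banach) = 0"
  using scaleC_add_right[of c "0::'b" 0] by simp

lemma scaleC_minus_right: "c *\<^sub>C (- x) = - (c *\<^sub>C (x::'b::complex_banach))"
  using scaleC_add_right[of c x "- x"] by (simp add: eq_neg_iff_add_eq_0 add.commute)

lemma scaleC_diff_right: "c *\<^sub>C (x - y) = c *\<^sub>C x - c *\<^sub>C (y::'b::complex_banach)"
  using scaleC_add_right[of c x "- y"] by (simp add: scaleC_minus_right)

lemma scaleC_one [simp]: "1 *\<^sub>C x = (x::'b::complex_banach)"
  using scaleR_scaleC[of 1 x] by simp

lemma scaleC_diff_left: "(c - d) *\<^sub>C x = c *\<^sub>C x - d *\<^sub>C (x::'b::complex_banach)"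
  using scaleC_add_left[of "c - d" d x] by simp

lemma scaleC_minus_left: "(- c) *\<^sub>C x = - (c *\<^sub>C (x::'b::complex_banach))"
  using scaleC_add_left[of "- c" c x] scaleR_scaleC[of 0 x] by (simp add: eq_neg_iff_add_eq_0)

lemma star_zero [simp]: "star (0::'a::unital_cstar_algebra) = 0"
  using star_add[of "0::'a" 0] by simp

lemma star_minus: "star (- a) = - star (a::'a::unital_cstar_algebra)"
  using star_add[of a "- a"] by (simp add: eq_neg_iff_add_eq_0 add.commute)

lemma star_diff: "star (a - b) = star a - star (b::'a::unital_cstar_algebra)"
  using star_add[of a "- b"] by (simp add: star_minus)

lemma star_scaleR: "star (r *\<^sub>R a) = r *\<^sub>R star (a::'a::unital_cstar_algebra)"
  by (simp add: scaleR_scaleC star_scaleC)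

lemma star_one [simp]: "star (1::'a::unital_cstar_algebra) = 1"
  by (metis mult_1_right star_mult star_star)

lemmas star_simps = star_add star_diff star_minus star_scaleR star_mult star_star star_scaleC

lemma norm_star [simp]: "norm (star a) = norm (a::'a::unital_cstar_algebra)"
proof -
  have le: "norm b \<le> norm (star b)" for b :: 'a
  proof (cases "norm b = 0")
    case False
    have "norm b * norm b \<le> norm (star b) * norm b"
      using norm_mult_ineq[of "star b" b] by (simp add: cstar_identity power2_eq_square)
    with False show ?thesis by simp
  qed simp
  show ?thesis using le[of a] le[of "star a"] by (simp add: star_star)
qed

text \<open>The C*-identity gives \<open>norm 1 = (norm 1)\<^sup>2\<close>. Only an inequality can
  be claimed, as the unit of the zero algebra has norm 0.\<close>

lemma norm_one_le: "norm (1::'a::unital_cstar_algebra) \<le> 1"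
  using cstar_identity[of "1::'a"] by (auto simp: power2_eq_square)

lemma norm_scaleR_one_le: "norm (r *\<^sub>R (1::'a::unital_cstar_algebra)) \<le> \<bar>r\<bar>"
  using mult_left_mono[OF norm_one_le, of "\<bar>r\<bar>"] by simp

lemma norm_square_self_adjoint:
  "star b = b \<Longrightarrow> norm (b * b) = (norm (b::'a::unital_cstar_algebra))\<^sup>2"
  using cstar_identity[of b] by simp

lemma continuous_on_star: "continuous_on S (star :: 'a::unital_cstar_algebra \<Rightarrow> 'a)"
proof -
  have "bounded_linear (star :: 'a \<Rightarrow> 'a)"
    by (rule bounded_linear_intro[of _ 1]) (simp_all add: star_simps)
  then show ?thesis by (rule linear_continuous_on)
qed

section \<open>Square roots by fixed points\<close>

text \<open>With \<open>1 - y\<close> as the square root of \<open>1 - z\<close>, \<open>y\<close> is the fixed point of \<open>y \<mapsto> (z + y\<^sup>2) / 2\<close>, which is a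
  contraction of the ball of radius \<open>norm z\<close>.\<close>

lemma sqrt_one_minus:
  fixes z :: "'a::unital_cstar_algebra"
  assumes sa: "star z = z" and z: "norm z < 1"
  obtains y where "star y = y" "norm y < 1" "(1 - y) * (1 - y) = 1 - z"
    "\<And>w. w * z = z * w \<Longrightarrow> w * y = y * w"
proof -
  \<comment> \<open>Self-adjointness and commutation with the commutant of \<open>z\<close> are
    closed conditions. They are built into \<open>K\<close> so that the fixed point inherits
    them.\<close>
  define K where "K = {y. norm y \<le> norm z} \<inter> {y. star y = y} \<inter>
    (\<Inter>w\<in>{w. w * z = z * w}. {y. w * y = y * w})"
  define f where "f y = (1/2) *\<^sub>R (z + y * y)" for y
  have K: "y \<in> K \<longleftrightarrow> norm y \<le> norm z \<and> star y = y \<and> (\<forall>w. w * z = z * w \<longrightarrow> w * y = y * w)" for y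
    unfolding K_def by blast
  have Kn: "norm y \<le> norm z" and Ks: "star y = y" and Kc: "w * z = z * w \<Longrightarrow> w * y = y * w"
    if "y \<in> K" for y w using that unfolding K_def by blast+
  have "closed K" unfolding K_def
    by (intro closed_Int closed_INT ballI closed_Collect_le closed_Collect_eq continuous_on_star
        continuous_intros)
  then have "complete K" by (simp add: complete_eq_closed)
  moreover have "0 \<in> K" by (simp add: K)
  moreover have "f ` K \<subseteq> K"
  proof (intro image_subsetI)
    fix y assume y: "y \<in> K"
    have "norm (y * y) \<le> norm z * norm z"
      using y by (intro order.trans[OF norm_mult_ineq] mult_mono) (simp_all add: Kn)
    also have "\<dots> \<le> norm z" using z by (simp add: mult_left_le)
    finally have "norm (f y) \<le> norm z"
      using norm_triangle_ineq[of z "y * y"] by (simp add: f_def)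
    moreover have "w * f y = f y * w" if "w * z = z * w" for w
    proof -
      have "w * y = y * w" using Kc[OF y that] .
      then have "w * (y * y) = (y * y) * w" by (metis mult.assoc)
      then show ?thesis using that by (simp add: f_def algebra_simps)
    qed
    moreover have "star (f y) = f y" using Ks[OF y] sa by (simp add: f_def star_simps)
    ultimately show "f y \<in> K" unfolding K by blast
  qed
  moreover have "\<forall>x\<in>K. \<forall>y\<in>K. dist (f x) (f y) \<le> norm z * dist x y"
  proof (intro ballI)
    fix x y assume "x \<in> K" "y \<in> K"
    note n = Kn[OF \<open>x \<in> K\<close>] Kn[OF \<open>y \<in> K\<close>]
    have f: "f x - f y = (1/2) *\<^sub>R (x * (x - y) + (x - y) * y)"
      by (simp add: f_def algebra_simps)
    have "norm (x * (x - y) + (x - y) * y) \<le> norm z * norm (x - y) + norm (x - y) * norm z"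
      using n by (intro order.trans[OF norm_triangle_ineq] add_mono order.trans[OF norm_mult_ineq]
          mult_right_mono mult_left_mono) auto
    then show "dist (f x) (f y) \<le> norm z * dist x y"
      unfolding dist_norm f by (simp add: mult.commute)
  qed
  ultimately have "\<exists>!y. y \<in> K \<and> f y = y"
    using z by (intro Banach_fix[of K "norm z" f]) (simp_all, blast)
  then obtain y where y: "y \<in> K" "f y = y" by blast
  have "y + y = z + y * y" using arg_cong[OF y(2), of "\<lambda>v. v + v"]
    by (simp add: f_def flip: scaleR_left_distrib)
  then have "(1 - y) * (1 - y) = 1 - z" by (simp add: algebra_simps)
  moreover note Kn[OF y(1)] Ks[OF y(1)]
  ultimately show ?thesis using z by (intro that[of y] Kc[OF y(1)]) simp_all
qed

section \<open>The positive cone described by norms\<close>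

text \<open>Positivity, phrased so that stability under sums is the triangle inequality. Such an \<open>M\<close> is
  automatically nonnegative, and for self-adjoint \<open>a\<close> this is equivalent to \<open>a\<close> having its spectrum
  in \<open>[0, \<infinity>)\<close>.\<close>

definition npos :: "'a::unital_cstar_algebra \<Rightarrow> bool" where
  "npos a \<longleftrightarrow> star a = a \<and> (\<exists>M. norm (M *\<^sub>R 1 - a) \<le> M)"

lemma npos_self_adjoint: "npos a \<Longrightarrow> star a = a"
  by (simp add: npos_def)

lemma npos_add:
  assumes "npos a" "npos b" shows "npos (a + b)"
proof -
  obtain M N where "norm (M *\<^sub>R 1 - a) \<le> M" "norm (N *\<^sub>R 1 - b) \<le> N"
    using assms by (auto simp: npos_def)
  then have "norm ((M *\<^sub>R 1 - a) + (N *\<^sub>R 1 - b)) \<le> M + N"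
    by (metis norm_triangle_mono)
  then have "norm ((M + N) *\<^sub>R 1 - (a + b)) \<le> M + N" by (simp add: algebra_simps)
  then show ?thesis using assms by (auto simp: npos_def star_simps)
qed

lemma npos_scaleR:
  assumes "npos a" "0 \<le> r" shows "npos (r *\<^sub>R a)"
proof -
  obtain M where "norm (M *\<^sub>R 1 - a) \<le> M" using assms by (auto simp: npos_def)
  then have "norm (r *\<^sub>R (M *\<^sub>R 1 - a)) \<le> r * M"
    using assms by (simp add: mult_left_mono)
  then have "norm ((r * M) *\<^sub>R 1 - r *\<^sub>R a) \<le> r * M" by (simp add: algebra_simps)
  then show ?thesis using assms by (auto simp: npos_def star_simps)
qed

lemma npos_norm_diff:
  assumes "star h = h" "norm h \<le> t" shows "npos (t *\<^sub>R 1 - h)"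
  using assms by (auto simp: npos_def star_simps intro!: exI[of _ t])

lemma npos_norm_add:
  assumes "star h = h" "norm h \<le> t" shows "npos (h + t *\<^sub>R 1)"
  using npos_norm_diff[of "- h" t] assms by (simp add: star_simps add.commute)

lemma npos_scaleR_one: "0 \<le> r \<Longrightarrow> npos (r *\<^sub>R 1)"
  using npos_norm_diff[of 0 r] by simp

text \<open>With \<open>t = M + s\<close> one has \<open>a + s = t (1 - z)\<close>, where
  \<open>z = (M - a) / t\<close> has norm at most \<open>M / t\<close>. The shift by
  \<open>s\<close> makes this less than 1, so that \<open>1 - z\<close> has a square root.\<close>

lemma npos_strict_sqrt:
  fixes a :: "'a::unital_cstar_algebra"
  assumes a: "npos a" and s: "0 < s"
  obtains b where "npos b" "b * b = a + s *\<^sub>R 1" "\<And>w. w * a = a * w \<Longrightarrow> w * b = b * w"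
proof -
  obtain M where M: "norm (M *\<^sub>R 1 - a) \<le> M" using a by (auto simp: npos_def)
  then have M0: "0 \<le> M" using norm_ge_zero order.trans by blast
  define t where "t = M + s"
  have t: "0 < t" using M0 s by (simp add: t_def)
  define z where "z = (1/t) *\<^sub>R (M *\<^sub>R 1 - a)"
  have "norm z < 1" using M t s by (simp add: z_def t_def divide_simps)
  moreover have "star z = z" using a by (simp add: z_def star_simps npos_def)
  ultimately obtain y where y: "star y = y" "norm y < 1" "(1 - y) * (1 - y) = 1 - z"
    and yc: "\<And>w. w * z = z * w \<Longrightarrow> w * y = y * w"
    using sqrt_one_minus by metis
  define b where "b = sqrt t *\<^sub>R (1 - y)"
  have "b * b = t *\<^sub>R (1 - z)" using t by (simp add: b_def y)
  also have "\<dots> = t *\<^sub>R 1 - (M *\<^sub>R 1 - a)" using t by (simp add: z_def algebra_simps)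
  also have "\<dots> = a + s *\<^sub>R 1" by (simp add: t_def algebra_simps)
  finally have bb: "b * b = a + s *\<^sub>R 1" .
  have "npos b" unfolding b_def
    using npos_norm_diff[of y 1] y t by (intro npos_scaleR) auto
  moreover have "w * b = b * w" if "w * a = a * w" for w
  proof -
    have "w * y = y * w" by (rule yc) (simp add: z_def algebra_simps that)
    then show ?thesis by (simp add: b_def algebra_simps)
  qed
  ultimately show ?thesis using bb that by blast
qed

text \<open>The element \<open>u = b + \<i> d\<close> satisfies \<open>u\<^sup>* u = t\<close>, and \<open>b\<close> and \<open>b\<^sup>2 - d\<^sup>2\<close> are the real parts of \<open>u\<close>
  and \<open>u\<^sup>2\<close>.\<close>

lemma norm_sum_two_squares:
  fixes b d :: "'a::unital_cstar_algebra"
  assumes sa: "star b = b" "star d = d" and c: "b * d = d * b"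
    and t: "b * b + d * d = t *\<^sub>R 1" "0 \<le> t"
  shows "(norm b)\<^sup>2 \<le> t" and "norm (b * b - d * d) \<le> t"
proof -
  define u where "u = b + \<i> *\<^sub>C d"
  have su: "star u = b - \<i> *\<^sub>C d"
    by (simp add: u_def star_simps sa scaleC_minus_left)
  have "star u * u = b * b + d * d"
    unfolding su by (simp add: u_def algebra_simps mult_scaleC_left mult_scaleC_right scaleC_scaleC
        scaleC_minus_left scaleC_add_right scaleC_diff_right c)
  then have "(norm u)\<^sup>2 \<le> t"
    using norm_scaleR_one_le[where r=t and 'a='a] cstar_identity[of u] t by simp
  have "b + b = u + star u" unfolding su by (simp add: u_def)
  then have "2 *\<^sub>R b = u + star u" by (simp add: scaleR_2)
  then have "2 * norm b \<le> 2 * norm u"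
    using norm_triangle_ineq[of u "star u"] by (metis abs_numeral norm_scaleR norm_star mult_2)
  then show "(norm b)\<^sup>2 \<le> t"
    using \<open>(norm u)\<^sup>2 \<le> t\<close> power_mono[of "norm b" "norm u" 2] by (meson norm_ge_zero order.trans mult_le_cancel_left_pos zero_less_numeral)
  have "(b * b - d * d) + (b * b - d * d) = u * u + star u * star u"
    unfolding su by (simp add: u_def algebra_simps mult_scaleC_left mult_scaleC_right scaleC_scaleC
        scaleC_minus_left scaleC_add_right scaleC_diff_right c)
  then have "2 *\<^sub>R (b * b - d * d) = u * u + star u * star u" by (simp add: scaleR_2)
  then have "2 * norm (b * b - d * d) = norm (u * u + star u * star u)"
    by (metis abs_numeral norm_scaleR)
  also have "\<dots> \<le> norm u * norm u + norm u * norm u"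
    using norm_mult_ineq[of u u] norm_mult_ineq[of "star u" "star u"]
    by (intro order.trans[OF norm_triangle_ineq] add_mono) simp_all
  finally show "norm (b * b - d * d) \<le> t"
    using \<open>(norm u)\<^sup>2 \<le> t\<close> by (simp add: power2_eq_square)
qed

text \<open>The element \<open>M - b * b\<close> is itself a square \<open>d * d\<close> with
  \<open>d\<close> commuting with \<open>b\<close>, so the two squares sum to \<open>M\<close> and
  \<open>norm_sum_two_squares\<close> bounds the norm of \<open>d\<close>.\<close>

lemma npos_square_norm_le:
  fixes b :: "'a::unital_cstar_algebra"
  assumes b: "star b = b" and M: "norm (b * b) < M"
  shows "norm (M *\<^sub>R 1 - b * b) \<le> M"
proof -
  have M0: "0 < M" using M norm_ge_zero by (rule le_less_trans[rotated])
  define z where "z = (1/M) *\<^sub>R (b * b)"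
  have "norm z < 1" "star z = z"
    using M M0 b by (simp_all add: z_def star_simps)
  then obtain y where y: "star y = y" "(1 - y) * (1 - y) = 1 - z"
    and yc: "\<And>w. w * z = z * w \<Longrightarrow> w * y = y * w"
    using sqrt_one_minus by metis
  define d where "d = sqrt M *\<^sub>R (1 - y)"
  have "d * d = M *\<^sub>R (1 - z)" using M0 by (simp add: d_def y)
  then have d: "d * d = M *\<^sub>R 1 - b * b" using M0 by (simp add: z_def algebra_simps)
  have sd: "star d = d" by (simp add: d_def star_simps y)
  have "b * y = y * b" by (rule yc) (simp add: z_def mult.assoc)
  then have "d * b = b * d" by (simp add: d_def algebra_simps)
  then have "(norm d)\<^sup>2 \<le> M" using M0 by (intro norm_sum_two_squares[of d b]) (simp_all add: sd b d)
  then show ?thesis by (simp add: norm_square_self_adjoint[OF sd] flip: d)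
qed

lemma npos_square: "star b = b \<Longrightarrow> npos (b * b)"
  unfolding npos_def
  by (auto simp: star_simps intro!: exI[of _ "norm (b * b) + 1"] npos_square_norm_le)

text \<open>This upgrades the single \<open>M\<close> in the definition of \<open>npos\<close> to
  every \<open>M\<close> above the norm: \<open>a + s\<close> is a square, to which
  \<open>npos_square_norm_le\<close> applies, and \<open>s\<close> can be made arbitrarily
  small.\<close>

lemma npos_norm_le:
  fixes a :: "'a::unital_cstar_algebra"
  assumes a: "npos a" and M: "norm a < M"
  shows "norm (M *\<^sub>R 1 - a) \<le> M"
proof (rule field_le_epsilon)
  fix e :: real assume e: "0 < e"
  define s where "s = min e ((M - norm a) / 2)"
  have s: "0 < s" "s \<le> e" "s < M - norm a" using e M by (auto simp: s_def min_def field_simps)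
  obtain b where b: "npos b" "b * b = a + s *\<^sub>R 1"
    using npos_strict_sqrt[OF a s(1)] by metis
  have "norm (b * b) < M" unfolding b
    using norm_triangle_ineq[of a "s *\<^sub>R 1"] norm_scaleR_one_le[where r=s and 'a='a] s by linarith
  then have "norm (M *\<^sub>R 1 - (a + s *\<^sub>R 1)) \<le> M"
    using npos_square_norm_le[of b M] b npos_self_adjoint by metis
  moreover have "M *\<^sub>R 1 - a = (M *\<^sub>R 1 - (a + s *\<^sub>R 1)) + s *\<^sub>R 1" by simp
  ultimately show "norm (M *\<^sub>R 1 - a) \<le> M + e"
    using norm_triangle_ineq[of "M *\<^sub>R 1 - (a + s *\<^sub>R 1)" "s *\<^sub>R 1"]
      norm_scaleR_one_le[where r=s and 'a='a] s by (metis abs_of_pos add_mono order.trans)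
qed

text \<open>By \<open>npos_norm_le\<close> the same constant \<open>norm a + 1\<close> serves for
  all \<open>a + s\<close> with \<open>s < 1\<close>, so the bound survives the limit.\<close>

lemma npos_closed:
  fixes a :: "'a::unital_cstar_algebra"
  assumes "\<And>s. 0 < s \<Longrightarrow> npos (a + s *\<^sub>R 1)"
  shows "npos a"
proof -
  have "star (a + 1 *\<^sub>R 1) = a + 1 *\<^sub>R 1" using assms[of 1] npos_self_adjoint by fastforce
  then have sa: "star a = a" by (simp add: star_simps)
  define M where "M = norm a + 1"
  have "norm (M *\<^sub>R 1 - a) \<le> M"
  proof (rule field_le_epsilon)
    fix e :: real assume e: "0 < e"
    define s where "s = min e (1/2)"
    have s: "0 < s" "s \<le> e" "s < 1" using e by (auto simp: s_def min_def)
    have "norm (a + s *\<^sub>R 1) < M" unfolding M_def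
      using norm_triangle_ineq[of a "s *\<^sub>R 1"] norm_scaleR_one_le[where r=s and 'a='a] s by linarith
    then have "norm (M *\<^sub>R 1 - (a + s *\<^sub>R 1)) \<le> M"
      using npos_norm_le assms s by blast
    moreover have "M *\<^sub>R 1 - a = (M *\<^sub>R 1 - (a + s *\<^sub>R 1)) + s *\<^sub>R 1" by simp
    ultimately show "norm (M *\<^sub>R 1 - a) \<le> M + e"
      using norm_triangle_ineq[of "M *\<^sub>R 1 - (a + s *\<^sub>R 1)" "s *\<^sub>R 1"]
        norm_scaleR_one_le[where r=s and 'a='a] s by (metis abs_of_pos add_mono order.trans)
  qed
  with sa show ?thesis by (auto simp: npos_def)
qed

text \<open>Up to a small \<open>e\<close>, both \<open>t - h\<close> and \<open>t + h\<close> are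
  squares of commuting elements. The squares sum to the scalar \<open>2 (t + e)\<close> and differ
  by \<open>2 h\<close>.\<close>

lemma norm_le_if_npos:
  fixes h :: "'a::unital_cstar_algebra"
  assumes "npos (t *\<^sub>R 1 - h)" "npos (t *\<^sub>R 1 + h)" "0 \<le> t"
  shows "norm h \<le> t"
proof (rule field_le_epsilon)
  fix e :: real assume e: "0 < e"
  obtain b where b: "npos b" "b * b = (t *\<^sub>R 1 - h) + e *\<^sub>R 1"
    and bc: "\<And>w. w * (t *\<^sub>R 1 - h) = (t *\<^sub>R 1 - h) * w \<Longrightarrow> w * b = b * w"
    using npos_strict_sqrt[OF assms(1) e] by metis
  obtain d where d: "npos d" "d * d = (t *\<^sub>R 1 + h) + e *\<^sub>R 1"
    and dc: "\<And>w. w * (t *\<^sub>R 1 + h) = (t *\<^sub>R 1 + h) * w \<Longrightarrow> w * d = d * w"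
    using npos_strict_sqrt[OF assms(2) e] by metis
  \<comment> \<open>Two passes through the commutation clauses: \<open>h\<close> commutes with
    \<open>b\<close>, hence \<open>b\<close> commutes with \<open>t + h\<close> and so with its root
    \<open>d\<close>.\<close>
  have "h * b = b * h" by (rule bc) (simp add: algebra_simps)
  then have "b * d = d * b" by (intro dc) (simp add: algebra_simps)
  then have "d * b = b * d" by simp
  then have "norm (d * d - b * b) \<le> 2 * (t + e)"
    using e assms(3)
    by (intro norm_sum_two_squares) (auto simp: npos_self_adjoint b d algebra_simps simp flip: scaleR_2)
  moreover have "d * d - b * b = 2 *\<^sub>R h" by (simp add: b d scaleR_2)
  ultimately show "norm h \<le> t + e" by simp
qed

lemma norm_mono_npos:
  fixes u v :: "'a::unital_cstar_algebra"
  assumes "npos u" "npos v" shows "norm u \<le> norm (u + v)"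
proof (rule norm_le_if_npos)
  show "npos (norm (u + v) *\<^sub>R 1 - u)"
    using npos_add[OF npos_norm_diff[of "u + v" "norm (u + v)"] assms(2)] assms
    by (simp add: npos_self_adjoint star_simps)
  show "npos (norm (u + v) *\<^sub>R 1 + u)" by (intro npos_add npos_scaleR_one assms) simp
qed simp

text \<open>If \<open>1 - y\<close> is the square root of \<open>1 - z\<close>, it commutes with
  \<open>b\<close>, and the element in question is the square of \<open>b * (1 - y)\<close>.\<close>

lemma npos_minus_square:
  fixes m :: "'a::unital_cstar_algebra"
  assumes "star z = z" "norm z < 1" "star b = b" "b * z = z * b"
  shows "npos (b * b - b * b * z)"
proof -
  obtain y where y: "star y = y" "(1 - y) * (1 - y) = 1 - z"
    and yc: "\<And>w. w * z = z * w \<Longrightarrow> w * y = y * w"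
    using sqrt_one_minus[OF assms(1,2)] by metis
  have c: "b * (1 - y) = (1 - y) * b" using yc[OF assms(4)] by (simp add: algebra_simps)
  have "(b * (1 - y)) * (b * (1 - y)) = b * (b * (1 - y)) * (1 - y)"
    using c by (metis mult.assoc)
  also have "\<dots> = b * b * (1 - z)" by (simp only: mult.assoc y(2))
  finally have "npos (b * b * (1 - z))"
    using npos_square[of "b * (1 - y)"] by (metis c star_diff star_mult star_one assms(3) y(1))
  then show ?thesis by (simp add: algebra_simps)
qed

section \<open>Positivity and invertibility of shifts\<close>

text \<open>If \<open>G 0\<close> failed, all members of \<open>G\<close> would be positive, their
  infimum would belong to \<open>G\<close>, and \<open>step\<close> would go below it. This drives
  the lowering of the shift both for algebra elements and for forms of operators.\<close>

lemma upward_closed_zero: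
  fixes G :: "real \<Rightarrow> bool"
  assumes start: "G t"
    and closed: "\<And>s. (\<And>e. 0 < e \<Longrightarrow> G (s + e)) \<Longrightarrow> G s"
    and upward: "\<And>s e. G s \<Longrightarrow> 0 \<le> e \<Longrightarrow> G (s + e)"
    and step: "\<And>s. 0 < s \<Longrightarrow> G s \<Longrightarrow> \<exists>s'<s. G s'"
  shows "G 0"
proof (rule ccontr)
  assume n: "\<not> G 0"
  have pos: "0 < s" if "G s" for s
    using upward[OF that, of "- s"] n by force
  define S where "S = {s. G s}"
  have bdd: "bdd_below S" unfolding S_def using pos by (intro bdd_belowI[of _ 0]) (auto intro: less_imp_le)
  have "G (Inf S)"
  proof (rule closed)
    fix e :: real assume "0 < e"
    then obtain s where "s \<in> S" "s < Inf S + e"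
      using start cInf_lessD[of S "Inf S + e"] by (auto simp: S_def)
    then show "G (Inf S + e)" using upward[of s "Inf S + e - s"] by (simp add: S_def)
  qed
  with step pos obtain s' where "s' < Inf S" "s' \<in> S" by (auto simp: S_def)
  then show False using cInf_lower[OF _ bdd] by fastforce
qed

text \<open>The number \<open>s\<close> can be lowered as long as \<open>a + s\<close> is invertible: up to a small \<open>\<epsilon>\<close>, \<open>a + s\<close> is a square \<open>b\<^sup>2\<close>,
  and \<open>b\<^sup>2 - \<delta> = b\<^sup>2 (1 - \<delta> b\<^sup>-\<^sup>2)\<close> is positive for small \<open>\<delta>\<close>.\<close>

lemma npos_if_invertible:
  fixes a :: "'a::unital_cstar_algebra"
  assumes sa: "star a = a"
    and inv: "\<And>s. 0 < s \<Longrightarrow> \<exists>e. (a + s *\<^sub>R 1) * e = 1 \<and> e * (a + s *\<^sub>R 1) = 1"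
  shows "npos a"
proof -
  have "npos (a + 0 *\<^sub>R 1)"
  proof (rule upward_closed_zero[where G = "\<lambda>s. npos (a + s *\<^sub>R 1)" and t = "norm a"])
    show "npos (a + norm a *\<^sub>R 1)" using sa by (intro npos_norm_add) auto
    show "npos (a + s *\<^sub>R 1)" if "\<And>e. 0 < e \<Longrightarrow> npos (a + (s + e) *\<^sub>R 1)" for s
      using that by (intro npos_closed[of "a + s *\<^sub>R 1"]) (simp add: algebra_simps)
    show "npos (a + (s + e) *\<^sub>R 1)" if "npos (a + s *\<^sub>R 1)" "0 \<le> e" for s e
      using npos_add[OF that(1) npos_scaleR_one[OF that(2)]] by (simp add: algebra_simps)
    fix s :: real assume s: "0 < s" "npos (a + s *\<^sub>R 1)"
    obtain e where e: "(a + s *\<^sub>R 1) * e = 1" "e * (a + s *\<^sub>R 1) = 1" using inv[OF s(1)] by blast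
    \<comment> \<open>Small enough for \<open>norm (\<delta> *\<^sub>R e') < 1\<close>, given the
      bound \<open>norm e' \<le> 2 * norm e\<close> proved below. The shift rises by
      \<open>\<epsilon>\<close> to obtain a square root and drops by \<open>\<delta>\<close>
      afterwards, so \<open>\<epsilon> < \<delta>\<close> yields a net decrease.\<close>
    define \<delta> where "\<delta> = 1 / (2 * norm e + 2)"
    have "0 < 2 * norm e + 2" using norm_ge_zero[of e] by linarith
    then have \<delta>: "0 < \<delta>" "\<delta> * (2 * norm e) < 1" by (simp_all add: \<delta>_def)
    define \<epsilon> where "\<epsilon> = \<delta> / 2"
    have \<epsilon>: "0 < \<epsilon>" "\<epsilon> < \<delta>" "\<epsilon> * norm e < 1/2"
      using \<delta> by (simp_all add: \<epsilon>_def)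
    define r where "r = a + (s + \<epsilon>) *\<^sub>R 1"
    have r: "r = (a + s *\<^sub>R 1) + \<epsilon> *\<^sub>R 1" by (simp add: r_def algebra_simps)
    obtain e' where e': "r * e' = 1" "e' * r = 1"
      using inv[of "s + \<epsilon>"] s \<epsilon> unfolding r_def by auto
    \<comment> \<open>The resolvent identity, used to bound the inverse \<open>e'\<close> of the
      shifted element by \<open>e\<close>.\<close>
    have "e * (r - (a + s *\<^sub>R 1)) * e' = (e * (r * e') - (e * (a + s *\<^sub>R 1)) * e')"
      by (simp add: right_diff_distrib left_diff_distrib mult.assoc)
    then have "e' = e - e * (r - (a + s *\<^sub>R 1)) * e'" by (simp add: e e')
    moreover have "r - (a + s *\<^sub>R 1) = \<epsilon> *\<^sub>R 1" by (simp add: r)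
    ultimately have "e' = e - \<epsilon> *\<^sub>R (e * e')" by simp
    then have "norm e' \<le> norm e + \<epsilon> * norm (e * e')"
      using \<epsilon> norm_triangle_ineq4[of e "\<epsilon> *\<^sub>R (e * e')"] by (metis abs_of_pos norm_scaleR)
    also have "\<dots> \<le> norm e + \<epsilon> * norm e * norm e'"
      using \<epsilon> norm_mult_ineq[of e e'] by simp
    also have "\<dots> \<le> norm e + 1/2 * norm e'"
      using \<epsilon> by (intro add_left_mono mult_right_mono) auto
    finally have "norm e' \<le> 2 * norm e" by simp
    then have "\<delta> * norm e' \<le> \<delta> * (2 * norm e)" using \<delta> by (intro mult_left_mono) auto
    then have "\<delta> * norm e' < 1" using \<delta>(2) by (rule le_less_trans)
    then have ze: "norm (\<delta> *\<^sub>R e') < 1" using \<delta>(1) by simp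
    obtain b where b: "npos b" "b * b = r"
      and bc: "\<And>w. w * (a + s *\<^sub>R 1) = (a + s *\<^sub>R 1) * w \<Longrightarrow> w * b = b * w"
      using npos_strict_sqrt[OF s(2) \<epsilon>(1)] unfolding r by metis
    have sr: "star r = r" by (simp add: r_def star_simps sa)
    have se: "star e' = e'"
      using e' sr by (metis mult.assoc mult_1_left mult_1_right star_mult star_one)
    have "r * b = b * r" using b(2) mult.assoc by metis
    then have "b * e' = e' * b" using e' by (metis mult.assoc mult_1_left mult_1_right)
    then have "npos (b * b - b * b * (\<delta> *\<^sub>R e'))"
      using ze b(1) by (intro npos_minus_square) (simp_all add: star_simps se npos_self_adjoint)
    then have "npos (a + (s + \<epsilon> - \<delta>) *\<^sub>R 1)"
      by (simp add: b(2) e') (simp add: r_def algebra_simps)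
    then show "\<exists>s'<s. npos (a + s' *\<^sub>R 1)" using \<epsilon> by (intro exI[of _ "s + \<epsilon> - \<delta>"]) auto
  qed
  then show ?thesis by simp
qed

lemma npos_if_cstar_positive:
  fixes a :: "'a::unital_cstar_algebra"
  assumes "cstar_positive a" shows "npos a"
proof (rule npos_if_invertible)
  show "star a = a" using assms by (simp add: cstar_positive_def)
  fix s :: real assume s: "0 < s"
  have "complex_of_real (- s) \<notin> \<real>\<^sub>\<ge>\<^sub>0"
    using s by (simp add: complex_nonneg_Reals_iff)
  then have "complex_of_real (- s) \<notin> cstar_spectrum a"
    using assms by (auto simp: cstar_positive_def)
  moreover have eq: "a - complex_of_real (- s) *\<^sub>C 1 = a + s *\<^sub>R 1"
    by (metis diff_minus_eq_add scaleR_minus_left scaleR_scaleC)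
  ultimately show "\<exists>e. (a + s *\<^sub>R 1) * e = 1 \<and> e * (a + s *\<^sub>R 1) = 1"
    by (simp only: cstar_spectrum_def mem_Collect_eq not_not eq)
qed

text \<open>In place of the Neumann series, right and left inverses are fixed points of the
  contractions \<open>y \<mapsto> 1 + z y\<close> and \<open>y \<mapsto> 1 + y z\<close>; they
  coincide by associativity.\<close>

lemma inverse_one_minus:
  fixes z :: "'a::unital_cstar_algebra"
  assumes z: "norm z < 1"
  obtains e where "(1 - z) * e = 1" "e * (1 - z) = 1"
proof -
  have "\<exists>!y. 1 + z * y = y"
    using z norm_mult_ineq[of z]
    by (intro banach_fix_type[of "norm z"]) (simp_all add: dist_norm flip: right_diff_distrib)
  then obtain y where y: "1 + z * y = y" by blast
  have "\<exists>!y. 1 + y * z = y"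
    using z norm_mult_ineq[of _ z]
    by (intro banach_fix_type[of "norm z"]) (simp_all add: dist_norm mult.commute[of "norm z"] flip: left_diff_distrib)
  then obtain y' where y': "1 + y' * z = y'" by blast
  have 1: "(1 - z) * y = 1" using y by (simp add: algebra_simps)
  have 2: "y' * (1 - z) = 1" using y' by (simp add: algebra_simps)
  have "y' = y" using 1 2 by (metis mult.assoc mult_1_left mult_1_right)
  with 1 2 that show ?thesis by blast
qed

lemma npos_invertible:
  fixes a :: "'a::unital_cstar_algebra"
  assumes a: "npos a" and s: "0 < s"
  obtains e where "(a + s *\<^sub>R 1) * e = 1" "e * (a + s *\<^sub>R 1) = 1"
proof -
  obtain M where M: "norm (M *\<^sub>R 1 - a) \<le> M" using a by (auto simp: npos_def)
  then have M0: "0 \<le> M" using norm_ge_zero order.trans by blast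
  define t where "t = M + s"
  have t: "0 < t" using M0 s by (simp add: t_def)
  define z where "z = (1/t) *\<^sub>R (M *\<^sub>R 1 - a)"
  have "norm z < 1" using M t s by (simp add: z_def t_def divide_simps)
  then obtain e where e: "(1 - z) * e = 1" "e * (1 - z) = 1" by (rule inverse_one_minus)
  have "t *\<^sub>R (1 - z) = t *\<^sub>R 1 - (M *\<^sub>R 1 - a)" using t by (simp add: z_def algebra_simps)
  then have "a + s *\<^sub>R 1 = t *\<^sub>R (1 - z)" by (simp add: t_def algebra_simps)
  with e t show ?thesis by (intro that[of "(1/t) *\<^sub>R e"]) simp_all
qed

text \<open>For \<open>s > 0\<close>, an inverse \<open>e\<close> of \<open>b a + s\<close> yields the inverse \<open>(1 - a e b) / s\<close> of \<open>a b + s\<close>.\<close>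

lemma invertible_mult_commute:
  fixes a b :: "'a::unital_cstar_algebra"
  assumes s: "0 < s" and e: "(b * a + s *\<^sub>R 1) * e = 1" "e * (b * a + s *\<^sub>R 1) = 1"
  shows "\<exists>e'. (a * b + s *\<^sub>R 1) * e' = 1 \<and> e' * (a * b + s *\<^sub>R 1) = 1"
proof -
  have 1: "b * a * e = 1 - s *\<^sub>R e" using e(1) by (simp add: algebra_simps)
  have 2: "e * (b * a) = 1 - s *\<^sub>R e" using e(2) by (simp add: algebra_simps)
  have "(a * b + s *\<^sub>R 1) * (1 - a * e * b) = a * b + s *\<^sub>R 1 - a * (b * a * e) * b - s *\<^sub>R (a * e * b)"
    by (simp add: algebra_simps)
  also have "\<dots> = s *\<^sub>R 1" unfolding 1 by (simp add: algebra_simps)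
  finally have "(a * b + s *\<^sub>R 1) * ((1/s) *\<^sub>R (1 - a * e * b)) = 1" using s by simp
  moreover have "(1 - a * e * b) * (a * b + s *\<^sub>R 1) = a * b + s *\<^sub>R 1 - a * (e * (b * a)) * b - s *\<^sub>R (a * e * b)"
    by (simp add: algebra_simps)
  then have "(1 - a * e * b) * (a * b + s *\<^sub>R 1) = s *\<^sub>R 1" unfolding 2 by (simp add: algebra_simps)
  then have "((1/s) *\<^sub>R (1 - a * e * b)) * (a * b + s *\<^sub>R 1) = 1" using s by simp
  ultimately show ?thesis by blast
qed

text \<open>The spectra of \<open>a * b\<close> and \<open>b * a\<close> agree away from 0, and only
  shifts by \<open>t + s > 0\<close> are involved. The last hypothesis says that
  \<open>a * b\<close> is self-adjoint.\<close>

lemma npos_if_mult_commute: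
  fixes a b :: "'a::unital_cstar_algebra"
  assumes "npos (b * a + t *\<^sub>R 1)" "0 \<le> t" "star b * star a = a * b"
  shows "npos (a * b + t *\<^sub>R 1)"
proof (rule npos_if_invertible)
  fix s :: real assume s: "0 < s"
  obtain e where "(b * a + (t + s) *\<^sub>R 1) * e = 1" "e * (b * a + (t + s) *\<^sub>R 1) = 1"
    using npos_invertible[OF assms(1) s] by (metis add.assoc scaleR_left_distrib)
  then obtain e' where "(a * b + (t + s) *\<^sub>R 1) * e' = 1" "e' * (a * b + (t + s) *\<^sub>R 1) = 1"
    using invertible_mult_commute[of "t + s" b a e] s assms(2) by auto
  then show "\<exists>e. (a * b + t *\<^sub>R 1 + s *\<^sub>R 1) * e = 1 \<and> e * (a * b + t *\<^sub>R 1 + s *\<^sub>R 1) = 1"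
    by (metis add.assoc scaleR_left_distrib)
qed (simp add: star_simps assms)

section \<open>Positivity of \<open>star x * x\<close> and of conjugates\<close>

text \<open>If \<open>- y\<^sup>* y\<close> is almost positive, then so is \<open>y y\<^sup>* = 2 (Re y)\<^sup>2 + 2 (Im y)\<^sup>2 - y\<^sup>* y\<close>, hence also
  \<open>y\<^sup>* y\<close>.\<close>

lemma norm_le_if_npos_minus:
  fixes y :: "'a::unital_cstar_algebra"
  assumes "npos (t *\<^sub>R 1 - star y * y)" "0 \<le> t"
  shows "norm (star y * y) \<le> t"
proof -
  \<comment> \<open>These are, up to sign, twice the real and imaginary parts of
    \<open>y\<close>.\<close>
  define u where "u = y + star y"
  define v where "v = \<i> *\<^sub>C (y - star y)"
  have "star u = u" by (simp add: u_def star_simps add.commute)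
  moreover have "star v = v"
    by (simp add: v_def star_simps scaleC_minus_left scaleC_diff_right)
  ultimately have "npos ((1/2) *\<^sub>R (u * u + v * v))"
    by (intro npos_scaleR npos_add npos_square) auto
  moreover have "u * u + v * v = 2 *\<^sub>R (y * star y + star y * y)"
    by (simp add: u_def v_def mult_scaleC_left mult_scaleC_right scaleC_scaleC scaleC_minus_left
        scaleC_diff_right algebra_simps scaleR_2)
  ultimately have "npos (y * star y + star y * y)" by simp
  from npos_add[OF this assms(1)] have "npos (y * star y + t *\<^sub>R 1)"
    by (simp add: algebra_simps)
  then have "npos (star y * y + t *\<^sub>R 1)"
    using assms(2) by (rule npos_if_mult_commute) (simp add: star_simps)
  then have "npos (t *\<^sub>R 1 + star y * y)" by (simp only: add.commute)
  then show ?thesis by (rule norm_le_if_npos[OF assms(1) _ assms(2)])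
qed


text \<open>For small \<open>s\<close> the perturbation \<open>s k\<close> is at most
  \<open>e\<close>, so \<open>a + e\<close> is the sum of the positive elements
  \<open>a + s k\<close> and \<open>e - s k\<close>.\<close>

lemma npos_limit:
  fixes a k :: "'a::unital_cstar_algebra"
  assumes k: "star k = k" and "\<And>s. 0 < s \<Longrightarrow> npos (a + s *\<^sub>R k)"
  shows "npos a"
proof (rule npos_closed)
  fix e :: real assume e: "0 < e"
  define s where "s = e / (norm k + 1)"
  have "0 < norm k + 1" using norm_ge_zero[of k] by linarith
  then have s: "0 < s" "s * norm k \<le> e" using e by (simp_all add: s_def field_simps)
  have "npos ((a + s *\<^sub>R k) + (e *\<^sub>R 1 - s *\<^sub>R k))"
    using s assms by (intro npos_add[of "a + s *\<^sub>R k"] npos_norm_diff) (simp_all add: star_simps)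
  then show "npos (a + e *\<^sub>R 1)" by simp
qed

text \<open>For \<open>b\<close> the square root of \<open>m + s\<close>, which commutes with
  \<open>m\<close>, the square of \<open>b * m\<close> is
  \<open>m\<^sup>3 + s m\<^sup>2\<close>.\<close>

lemma npos_cube:
  fixes m :: "'a::unital_cstar_algebra"
  assumes m: "npos m" shows "npos (m * m * m)"
proof (rule npos_limit)
  show "star (m * m) = m * m" using m by (simp add: star_simps npos_self_adjoint)
  fix s :: real assume s: "0 < s"
  obtain b where b: "npos b" "b * b = m + s *\<^sub>R 1" and bc: "m * b = b * m"
    using npos_strict_sqrt[OF m s] by metis
  have "(b * m) * (b * m) = (b * b) * (m * m)" using bc by (metis mult.assoc)
  then have "(b * m) * (b * m) = m * m * m + s *\<^sub>R (m * m)" by (simp add: b algebra_simps)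
  moreover have "npos ((b * m) * (b * m))"
    using bc b m by (intro npos_square) (simp add: star_simps npos_self_adjoint)
  ultimately show "npos (m * m * m + s *\<^sub>R (m * m))" by simp
qed

text \<open>With \<open>h = x\<^sup>* x\<close> and \<open>p = (h\<^sup>2 + \<epsilon>)\<^sup>1\<^sup>/\<^sup>2\<close>, the element \<open>m = (p - h) / 2\<close> is an approximate negative
  part of \<open>h\<close>, and \<open>y = x m\<close> satisfies \<open>y\<^sup>* y = \<epsilon> m / 4 - m\<^sup>3\<close>; so \<open>m\<close> is small.\<close>

lemma npos_star_mult:
  fixes x :: "'a::unital_cstar_algebra"
  shows "npos (star x * x)"
proof (rule npos_closed)
  fix r :: real assume r: "0 < r"
  define h where "h = star x * x"
  have sh: "star h = h" by (simp add: h_def star_simps)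
  define K where "K = norm h + 1"
  have K: "0 < K" using norm_ge_zero[of h] unfolding K_def by linarith
  \<comment> \<open>The bound 1 gives \<open>norm p \<le> K\<close>; the other bound will make the
    norm of \<open>m\<^sup>3\<close> at most \<open>(r / 2)\<^sup>3\<close>.\<close>
  define \<epsilon> where "\<epsilon> = min 1 (r ^ 3 / (4 * K))"
  have \<epsilon>: "0 < \<epsilon>" "\<epsilon> \<le> 1" "\<epsilon> \<le> r ^ 3 / (4 * K)" using r K by (simp_all add: \<epsilon>_def)
  then have \<epsilon>K: "\<epsilon> * K / 2 \<le> (r / 2) ^ 3" using K by (simp add: field_simps power3_eq_cube)
  obtain p where p: "npos p" "p * p = h * h + \<epsilon> *\<^sub>R 1" and hp: "h * p = p * h"
    using npos_strict_sqrt[OF npos_square[OF sh] \<epsilon>(1)] by (metis mult.assoc)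
  have "(norm p)\<^sup>2 = norm (h * h + \<epsilon> *\<^sub>R 1)"
    using p norm_square_self_adjoint npos_self_adjoint by metis
  also have "\<dots> \<le> norm (h * h) + \<epsilon>"
    using norm_triangle_ineq[of "h * h" "\<epsilon> *\<^sub>R 1"] norm_scaleR_one_le[where r=\<epsilon> and 'a='a] \<epsilon>
    by linarith
  also have "\<dots> \<le> K\<^sup>2" using \<epsilon>(2) norm_ge_zero[of h]
    unfolding norm_square_self_adjoint[OF sh] K_def power2_sum one_power2 mult_1_right by linarith
  finally have pK: "norm p \<le> K" using K by (rule power2_le_imp_le[OF _ less_imp_le])
  define m where "m = (1/2) *\<^sub>R (p - h)"
  have "norm m \<le> K" using norm_triangle_ineq4[of p h] pK by (simp add: m_def K_def)
  have hm: "h = p - 2 *\<^sub>R m" by (simp add: m_def)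
  have pph: "(p - h) * (p + h) = \<epsilon> *\<^sub>R 1" using hp by (simp add: algebra_simps p)
  have "npos (p - h)"
  proof (rule npos_if_invertible)
    show "star (p - h) = p - h" using p sh by (simp add: star_simps npos_self_adjoint)
    fix s :: real assume s: "0 < s"
    \<comment> \<open>Chosen so that \<open>(p - h + s) (p + h + s) = 2 s (p + c)\<close>. The right
      side is invertible because \<open>p\<close> is positive, hence so is the factor
      \<open>p - h + s\<close>.\<close>
    define c where "c = (\<epsilon> + s * s) / (2 * s)"
    have c: "0 < c" using s \<epsilon> by (simp add: c_def add_pos_pos)
    obtain e where e: "(p + c *\<^sub>R 1) * e = 1" "e * (p + c *\<^sub>R 1) = 1"
      using npos_invertible[OF p(1) c] by blast
    define X Y where "X = p - h + s *\<^sub>R 1" and "Y = p + h + s *\<^sub>R 1"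
    have "(2 * s) *\<^sub>R (p + c *\<^sub>R 1) = (2 * s) *\<^sub>R p + (\<epsilon> + s * s) *\<^sub>R 1"
      using s unfolding scaleR_right_distrib scaleR_scaleR by (simp add: c_def)
    moreover have "(p + h) * (p - h) = \<epsilon> *\<^sub>R 1" using hp by (simp add: algebra_simps p)
    moreover have "(p - h) + (p + h) = 2 *\<^sub>R p" by (simp add: scaleR_2)
    moreover have "X * Y = (p - h) * (p + h) + s *\<^sub>R ((p - h) + (p + h)) + (s * s) *\<^sub>R 1"
      "Y * X = (p + h) * (p - h) + s *\<^sub>R ((p - h) + (p + h)) + (s * s) *\<^sub>R 1"
      unfolding X_def Y_def by (simp_all add: algebra_simps)
    ultimately have "(2 * s) *\<^sub>R (p + c *\<^sub>R 1) = (2 * s) *\<^sub>R p + (\<epsilon> + s * s) *\<^sub>R 1"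
      "X * Y = \<epsilon> *\<^sub>R 1 + s *\<^sub>R 2 *\<^sub>R p + (s * s) *\<^sub>R 1" "Y * X = \<epsilon> *\<^sub>R 1 + s *\<^sub>R 2 *\<^sub>R p + (s * s) *\<^sub>R 1"
      using pph by presburger+
    then have XY: "X * Y = (2 * s) *\<^sub>R (p + c *\<^sub>R 1)" "Y * X = (2 * s) *\<^sub>R (p + c *\<^sub>R 1)"
      by (simp_all add: algebra_simps)
    define e' where "e' = (1 / (2 * s)) *\<^sub>R e"
    have "X * Y * e' = 1" "e' * (Y * X) = 1" using s e by (simp_all add: XY e'_def)
    then have X: "X * (Y * e') = 1" "(e' * Y) * X = 1" by (simp_all only: mult.assoc)
    have "e' * Y = (e' * Y) * (X * (Y * e'))" by (simp only: X mult_1_right)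
    also have "\<dots> = ((e' * Y) * X) * (Y * e')" by (simp only: mult.assoc)
    finally have "e' * Y = Y * e'" by (simp only: X mult_1_left)
    with X show "\<exists>e. (p - h + s *\<^sub>R 1) * e = 1 \<and> e * (p - h + s *\<^sub>R 1) = 1"
      unfolding X_def by metis
  qed
  then have m: "npos m" by (simp add: m_def npos_scaleR)
  then have sm: "star m = m" by (rule npos_self_adjoint)
  have "2 *\<^sub>R m = p - h" by (simp add: m_def)
  moreover have "2 *\<^sub>R (p - m) = p + h" by (simp add: m_def scaleR_right_diff_distrib scaleR_2)
  moreover have "4 *\<^sub>R (m * (p - m)) = (2 *\<^sub>R m) * (2 *\<^sub>R (p - m))" by simp
  ultimately have "4 *\<^sub>R (m * (p - m)) = \<epsilon> *\<^sub>R 1" by (simp only: pph)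
  then have "4 *\<^sub>R (m * (p - m)) = 4 *\<^sub>R ((\<epsilon> / 4) *\<^sub>R 1)" by simp
  then have "m * (p - m) = (\<epsilon> / 4) *\<^sub>R 1" unfolding scaleR_cancel_left by simp
  then have mp: "m * p = m * m + (\<epsilon> / 4) *\<^sub>R 1" by (simp add: algebra_simps)
  define y where "y = x * m"
  have "star y * y = m * h * m" by (simp add: y_def star_simps sm h_def mult.assoc)
  also have "\<dots> = m * p * m - 2 *\<^sub>R (m * m * m)" unfolding hm by (simp add: algebra_simps)
  also have "\<dots> = (\<epsilon> / 4) *\<^sub>R m - m * m * m" unfolding mp by (simp add: algebra_simps scaleR_2)
  finally have yy: "star y * y = (\<epsilon> / 4) *\<^sub>R m - m * m * m" .
  define \<eta> where "\<eta> = \<epsilon> * K / 4"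
  have \<eta>: "0 \<le> \<eta>" using \<epsilon> K by (simp add: \<eta>_def)
  have "norm ((\<epsilon> / 4) *\<^sub>R m) \<le> \<eta>"
    using \<epsilon> \<open>norm m \<le> K\<close> by (simp add: \<eta>_def)
  then have "npos ((\<eta> *\<^sub>R 1 - (\<epsilon> / 4) *\<^sub>R m) + m * m * m)"
    using m by (intro npos_add npos_norm_diff npos_cube) (simp_all add: star_simps sm)
  then have "norm (star y * y) \<le> \<eta>"
    using \<eta> by (intro norm_le_if_npos_minus) (simp_all add: yy algebra_simps)
  moreover have "norm (m * m * m) \<le> norm ((\<epsilon> / 4) *\<^sub>R m) + norm (star y * y)"
    using norm_triangle_ineq4[of "(\<epsilon> / 4) *\<^sub>R m" "star y * y"] unfolding yy by simp
  ultimately have m3: "norm (m * m * m) \<le> \<epsilon> * K / 2"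
    using \<open>norm ((\<epsilon> / 4) *\<^sub>R m) \<le> \<eta>\<close>
    unfolding \<eta>_def by linarith
  have "norm m \<le> r / 2"
  proof (rule ccontr)
    assume "\<not> norm m \<le> r / 2"
    then have mr: "r / 2 < norm m" by simp
    \<comment> \<open>The C*-identity applied twice gives \<open>norm m ^ 4\<close> as the norm of
      the fourth power, which is at most the norm of the cube times \<open>norm m\<close>.\<close>
    have "norm m ^ 3 * norm m = (norm (m * m))\<^sup>2"
      by (simp add: norm_square_self_adjoint[OF sm] power2_eq_square power3_eq_cube)
    also have "\<dots> = norm (m * m * m * m)"
      by (subst norm_square_self_adjoint[symmetric]) (simp_all add: star_simps sm mult.assoc)
    moreover have "norm (m * m * m * m) \<le> (r / 2) ^ 3 * norm m"
      using m3 \<epsilon>K by (intro order.trans[OF norm_mult_ineq[of "m * m * m"]] mult_right_mono) auto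
    moreover have "0 < norm m" using mr r by linarith
    ultimately have "norm m ^ 3 \<le> (r / 2) ^ 3" by (metis mult_right_le_imp_le)
    moreover have "(r / 2) ^ 3 < norm m ^ 3" using mr r by (intro power_strict_mono) auto
    ultimately show False by simp
  qed
  then have "npos (p + (r *\<^sub>R 1 - 2 *\<^sub>R m))"
    using p by (intro npos_add npos_norm_diff) (simp_all add: star_simps sm)
  then show "npos (star x * x + r *\<^sub>R 1)"
    unfolding h_def[symmetric] by (simp add: hm algebra_simps)
qed

text \<open>With \<open>b\<close> the square root of \<open>c + s\<close>, the conjugate of
  \<open>c + s\<close> by \<open>a\<close> is \<open>star (b * a) * (b * a)\<close>.\<close>

lemma npos_conj:
  fixes a c :: "'a::unital_cstar_algebra"
  assumes c: "npos c" shows "npos (star a * c * a)"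
proof (rule npos_limit)
  show "star (star a * a) = star a * a" by (simp add: star_simps)
  fix s :: real assume s: "0 < s"
  obtain b where b: "npos b" "b * b = c + s *\<^sub>R 1" using npos_strict_sqrt[OF c s] by metis
  have "star (b * a) * (b * a) = star a * (b * b) * a"
    using b(1) by (simp add: star_simps npos_self_adjoint mult.assoc)
  also have "\<dots> = star a * c * a + s *\<^sub>R (star a * a)" by (simp add: b algebra_simps)
  finally show "npos (star a * c * a + s *\<^sub>R (star a * a))"
    using npos_star_mult[of "b * a"] by simp
qed

section \<open>Order from norm inequalities\<close>

text \<open>Test with \<open>a = (v + \<epsilon>)\<^sup>-\<^sup>1\<^sup>/\<^sup>2\<close>.\<close>

lemma npos_diff_if_norm_le:
  fixes u v :: "'a::unital_cstar_algebra"
  assumes u: "star u = u" and v: "npos v"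
    and le: "\<And>a. norm (star a * u * a) \<le> norm (star a * v * a)"
  shows "npos (v - u)"
proof (rule npos_closed)
  fix s :: real assume s: "0 < s"
  obtain g where g: "npos g" "g * g = v + s *\<^sub>R 1" and gc: "v * g = g * v"
    using npos_strict_sqrt[OF v s] by metis
  obtain e where e: "(v + s *\<^sub>R 1) * e = 1" "e * (v + s *\<^sub>R 1) = 1"
    using npos_invertible[OF v s] by blast
  define a where "a = g * e"
  have ga: "g * a = 1" unfolding a_def by (simp add: g(2) e flip: mult.assoc)
  have "(e * g) * g = 1" by (simp add: mult.assoc g(2) e)
  then have ag: "a * g = 1" using ga by (metis mult.assoc mult_1_left mult_1_right)
  have sg: "star g = g" using g(1) by (rule npos_self_adjoint)
  have sa: "star a = a"
    using ga ag sg by (metis mult.assoc mult_1_left mult_1_right star_mult star_one)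
  have "a * (g * g) * a = 1" by (metis ag ga mult.assoc mult_1_left)
  then have "a * v * a + s *\<^sub>R (a * a) = 1" by (simp add: g(2) algebra_simps)
  then have "1 - a * v * a = s *\<^sub>R (a * a)" by (metis add_diff_cancel_left')
  then have "npos (1 - a * v * a)" using s sa by (simp add: npos_scaleR npos_square)
  moreover have ava: "npos (a * v * a)" using npos_conj[OF v, of a] sa by simp
  moreover from this have "npos (1 *\<^sub>R 1 + a * v * a)" by (intro npos_add npos_scaleR_one) auto
  ultimately have "norm (a * v * a) \<le> 1" by (intro norm_le_if_npos) auto
  then have "norm (a * u * a) \<le> 1" using le[of a] sa by simp
  then have "npos (1 *\<^sub>R 1 - a * u * a)"
    by (intro npos_norm_diff) (simp_all add: star_simps sa u mult.assoc)
  \<comment> \<open>Conjugating by \<open>g\<close>, the inverse of \<open>a\<close>, turns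
    \<open>a u a \<le> 1\<close> into \<open>u \<le> g\<^sup>2 = v + s\<close>.\<close>
  then have "npos (g * (1 - a * u * a) * g)" using npos_conj[of "1 - a * u * a" g] sg by simp
  moreover have "g * (1 - a * u * a) * g = g * g - (g * a) * u * (a * g)"
    by (simp add: algebra_simps)
  ultimately show "npos (v - u + s *\<^sub>R 1)" by (simp add: ga ag g(2) algebra_simps)
qed

text \<open>Squares of self-adjoint elements and the unit are preserved, hence so are positivity and
  the order bounds by \<open>norm a\<close>. Equality follows as \<open>sharp\<close> is its own
  inverse. This is what makes a conjugation isometric.\<close>

lemma norm_star_conjugate_automorphism:
  fixes a :: "'a::unital_cstar_algebra"
  assumes sharp: "star_conjugate_automorphism sharp" and a: "star a = a"
  shows "norm (sharp a) = norm a"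
proof -
  have lin: "sharp (c *\<^sub>C x + y) = cnj c *\<^sub>C sharp x + sharp y"
    and inv: "sharp (sharp x) = x" and star: "star (sharp x) = sharp (star x)"
    and mult: "sharp (x * y) = sharp x * sharp y" for c x y
    using sharp by (auto simp: star_conjugate_automorphism_def)
  have add: "sharp (x + y) = sharp x + sharp y" for x y using lin[of 1 x y] by simp
  have zero: "sharp 0 = 0" using add[of 0 0] by simp
  have scale: "sharp (r *\<^sub>R x) = r *\<^sub>R sharp x" for r x
    using lin[of "of_real r" x 0] by (simp add: zero scaleR_scaleC)
  have one: "sharp 1 = 1" using mult[of 1 "sharp 1"] by (simp add: inv)
  have npos: "npos (sharp x)" if "npos x" for x
  proof (rule npos_closed)
    fix s :: real assume "0 < s"
    then obtain b where b: "npos b" "b * b = x + s *\<^sub>R 1" using npos_strict_sqrt \<open>npos x\<close> by metis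
    then have "npos (sharp b * sharp b)" by (intro npos_square) (simp add: star npos_self_adjoint)
    then show "npos (sharp x + s *\<^sub>R 1)" by (simp add: b add scale one flip: mult)
  qed
  have le: "norm (sharp x) \<le> norm x" if x: "star x = x" for x
  proof (rule norm_le_if_npos)
    show "npos (norm x *\<^sub>R 1 + sharp x)"
      using npos[OF npos_norm_add[OF x order.refl]] by (simp add: add scale one add.commute)
    have "sharp (- x) = - sharp x" using scale[of "- 1" x] by simp
    then show "npos (norm x *\<^sub>R 1 - sharp x)"
      using npos[OF npos_norm_add[of "- x" "norm x"]] x
        add[of "norm x *\<^sub>R 1" "- x"] by (simp add: scale one star_simps)
  qed simp
  show ?thesis using le[OF a] le[of "sharp a"] a by (simp add: inv star)
qed

section \<open>Adjointable operators on Hilbert modules\<close>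

text \<open>Take \<open>t = 1 / C\<close>; if \<open>C = 0\<close>, a large \<open>t\<close> forces
  \<open>B = 0\<close>.\<close>

lemma quadratic_discriminant_bound:
  fixes B C D :: real
  assumes "\<And>t. 0 < t \<Longrightarrow> 2 * t * B \<le> D + t\<^sup>2 * B * C" "0 \<le> B" "0 \<le> C" "0 \<le> D"
  shows "B \<le> C * D"
proof (cases "C = 0")
  case True
  have "B = 0"
  proof (rule ccontr)
    assume "B \<noteq> 0"
    then have B: "0 < B" using assms by simp
    have "0 < D / B + 1" using B assms(4) by (simp add: add_nonneg_pos)
    from assms(1)[OF this] have "2 * (D / B + 1) * B \<le> D" using True by simp
    moreover have "2 * (D / B + 1) * B = 2 * D + 2 * B" using B by (simp add: algebra_simps)
    ultimately show False using B assms(4) by linarith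
  qed
  then show ?thesis using assms by simp
next
  case False
  then have C: "0 < C" using assms by simp
  then have "2 * (1 / C) * B \<le> D + (1 / C)\<^sup>2 * B * C" by (intro assms(1)) simp
  also have "(1 / C)\<^sup>2 * B * C = B / C" using C by (simp add: power2_eq_square)
  finally show ?thesis using C by (simp add: field_simps)
qed

context hilbert_cstar_module
begin

lemma npos_ip: "npos (ip x x)"
  by (intro npos_if_cstar_positive ip_positive)

lemma norm_ip_self: "norm (ip x x) = (norm x)\<^sup>2"
  by (simp add: norm_eq_ip)

lemma ip_scaleR_right: "ip x (r *\<^sub>R y) = r *\<^sub>R ip x y"
  by (simp add: scaleR_scaleC ip_scaleC_right)

lemma ip_scaleR_left: "ip (r *\<^sub>R x) y = r *\<^sub>R ip x y"
  by (simp add: scaleR_scaleC ip_scaleC_left)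

lemma ip_diff_right: "ip x (y - z) = ip x y - ip x z"
  using ip_add_right[of x "y - z" z] by simp

lemma ip_diff_left: "ip (x - y) z = ip x z - ip y z"
  using ip_add_left[of "x - y" y z] by simp

lemma adjointable_linear_map:
  assumes "T \<in> adjointable ip" shows "linear T"
  using adjointable_linear[OF assms] by (intro linearI) (simp_all add: scaleR_scaleC)

lemma adjointableI: "(\<And>x y. ip (T x) y = ip x (S y)) \<Longrightarrow> T \<in> adjointable ip"
  by (auto simp: adjointable_def)

text \<open>Positivity of the form at \<open>y \<plusminus> x t b\<close>, where \<open>b = \<langle>x, R y\<rangle>\<close>, gives \<open>- v \<le> 2 t b\<^sup>* b \<le> v\<close> with
  \<open>v = \<langle>y, R y\<rangle> + t\<^sup>2 b\<^sup>* \<langle>x, R x\<rangle> b\<close>.\<close>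

lemma form_Cauchy_Schwarz:
  assumes sa: "\<And>x y. ip (R x) y = ip x (R y)" and pos: "\<And>x. npos (ip x (R x))"
  shows "(norm (ip x (R y)))\<^sup>2 \<le> norm (ip x (R x)) * norm (ip y (R y))"
proof (rule quadratic_discriminant_bound)
  define b where "b = ip x (R y)"
  note lin = adjointable_linear[OF adjointableI[OF sa]]
    linear_cmul[OF adjointable_linear_map[OF adjointableI[OF sa]]]
  have yx: "ip y (R x) = star b" by (simp add: b_def ip_star sa)
  define c where "c = star b * ip x (R x) * b"
  fix t :: real assume t: "0 < t"
  define v where "v = ip y (R y) + t\<^sup>2 *\<^sub>R c"
  define h where "h = t *\<^sub>R (star b * b) + t *\<^sub>R (star b * b)"
  have h: "h = (2 * t) *\<^sub>R (star b * b)" unfolding h_def mult_2 scaleR_left_distrib ..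
  have form: "ip (y + s *\<^sub>R act x b) (R (y + s *\<^sub>R act x b))
      = ip y (R y) + (s *\<^sub>R (star b * b) + s *\<^sub>R (star b * b)) + s\<^sup>2 *\<^sub>R c" for s
    by (simp add: lin ip_add_left ip_add_right ip_scaleR_left ip_scaleR_right ip_act_left
        ip_act_right yx c_def algebra_simps power2_eq_square flip: b_def)
  have "npos (v + h)" using pos[of "y + t *\<^sub>R act x b"]
    unfolding form by (simp add: v_def h_def algebra_simps)
  moreover have "npos (v - h)" using pos[of "y + (- t) *\<^sub>R act x b"]
    unfolding form by (simp add: v_def h_def algebra_simps)
  moreover have "star v = v"
    by (simp add: v_def c_def star_simps ip_star sa mult.assoc)
  \<comment> \<open>Passing from \<open>v\<close> to the scalar \<open>norm v\<close> turns the two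
    order bounds on \<open>h\<close> into a norm bound.\<close>
  then have "npos (norm v *\<^sub>R 1 - v)" by (rule npos_norm_diff) simp
  ultimately have "npos ((norm v *\<^sub>R 1 - v) + (v + h))" "npos ((norm v *\<^sub>R 1 - v) + (v - h))"
    by (simp_all only: npos_add)
  then have "norm h \<le> norm v" by (intro norm_le_if_npos) simp_all
  also have "norm v \<le> norm (ip y (R y)) + t\<^sup>2 * norm c"
    unfolding v_def by (intro order.trans[OF norm_triangle_ineq]) simp
  also have "norm c \<le> norm b * norm (ip x (R x)) * norm b"
    unfolding c_def using norm_mult_ineq[of "star b" "ip x (R x)"]
    by (intro order.trans[OF norm_mult_ineq] mult_right_mono) simp_all
  finally show "2 * t * (norm b)\<^sup>2 \<le> norm (ip y (R y)) + t\<^sup>2 * (norm b)\<^sup>2 * norm (ip x (R x))"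
    using t by (simp add: h cstar_identity power2_eq_square algebra_simps mult_left_mono)
qed simp_all

lemma norm_ip_le: "norm (ip x y) \<le> norm x * norm y"
  using form_Cauchy_Schwarz[of "\<lambda>x. x" x y]
  by (simp add: npos_ip norm_ip_self power_mult_distrib flip: power_mult_distrib)

section \<open>Boundedness of adjointable operators\<close>

text \<open>Continuity of \<open>T\<close> is not yet available, but the bound on \<open>T x\<close>
  is equivalent to bounds on \<open>ip (adj ip T z) x\<close> for all \<open>z\<close>, and these
  are continuous in \<open>x\<close> by Cauchy-Schwarz.\<close>

lemma closed_norm_adjointable_le:
  assumes T: "T \<in> adjointable ip" shows "closed {x. norm (T x) \<le> r}"
proof -
  have bl: "bounded_linear (ip z)" for z
    by (rule bounded_linear_intro[of _ "norm z"])
      (simp_all add: ip_add_right ip_scaleR_right norm_ip_le mult.commute[of _ "norm z"])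
  have "norm (T x) \<le> r \<longleftrightarrow> 0 \<le> r \<and> (\<forall>z. norm (ip (adj ip T z) x) \<le> r * norm z)" for x
  proof -
    have eq: "norm (ip (adj ip T z) x) = norm (ip z (T x))" for z
      using ip_adj[OF T, of x z] by (metis ip_star norm_star)
    show ?thesis
    proof (intro iffI conjI allI)
      assume r: "norm (T x) \<le> r"
      then show "0 \<le> r" using norm_ge_zero order.trans by blast
      show "norm (ip (adj ip T z) x) \<le> r * norm z" for z unfolding eq
        using norm_ip_le[of z "T x"] mult_left_mono[OF r, of "norm z"] by (simp add: mult.commute)
    next
      assume "0 \<le> r \<and> (\<forall>z. norm (ip (adj ip T z) x) \<le> r * norm z)"
      then have "norm (T x) * norm (T x) \<le> r * norm (T x)" "0 \<le> r"
        unfolding eq by (auto simp: norm_ip_self power2_eq_square dest: spec[of _ "T x"])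
      then show "norm (T x) \<le> r" by (cases "norm (T x) = 0") auto
    qed
  qed
  then have "{x. norm (T x) \<le> r} = {x. 0 \<le> r} \<inter> (\<Inter>z. {x. norm (ip (adj ip T z) x) \<le> r * norm z})"
    by auto
  moreover have "closed \<dots>"
    by (intro closed_Int closed_INT ballI closed_Collect_le closed_Collect_const
        continuous_intros linear_continuous_on bl)
  ultimately show ?thesis by simp
qed

text \<open>By Baire, one of the closed sets \<open>A n\<close> covering the space contains a ball;
  translation and scaling turn this into a bound on \<open>T\<close>.\<close>

lemma adjointable_bounded:
  assumes T: "T \<in> adjointable ip"
  obtains K where "0 \<le> K" "\<And>x. norm (T x) \<le> K * norm x"
proof -
  note lin = adjointable_linear_map[OF T]
  define A where "A n = {x. norm (T x) \<le> real n}" for n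
  have "(\<Union>n. A n) = UNIV" using real_arch_simple by (auto simp: A_def)
  have "\<exists>n. interior (A n) \<noteq> {}"
  proof (rule ccontr)
    assume "\<not> ?thesis"
    then have "Met_TC.mtopology interior_of (\<Union>(range A)) = {}"
      using closed_norm_adjointable_le[OF T]
      by (intro Met_TC.metric_Baire_category_alt)
        (auto simp: A_def complete_UNIV mcomplete_iff_complete)
    then show False using \<open>(\<Union>n. A n) = UNIV\<close> by simp
  qed
  then obtain n x where "x \<in> interior (A n)" by blast
  then obtain r where r: "0 < r" "ball x r \<subseteq> A n" by (meson mem_interior)
  define K where "K = 2 * (real n + real n) / r"
  have "norm (T y) \<le> K * norm y" for y
  proof (cases "y = 0")
    case False
    define t where "t = r / (2 * norm y)"
    have t: "0 < t" using r False by (simp add: t_def)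
    have "dist x (x + t *\<^sub>R y) < r" using r False by (simp add: dist_norm t_def)
    then have "norm (T (x + t *\<^sub>R y)) \<le> real n" "norm (T x) \<le> real n"
      using r by (auto simp: A_def subset_iff)
    moreover have "t *\<^sub>R T y = T (x + t *\<^sub>R y) - T x"
      by (simp add: linear_add[OF lin] linear_cmul[OF lin])
    ultimately have "norm (t *\<^sub>R T y) \<le> real n + real n"
      using norm_triangle_ineq4[of "T (x + t *\<^sub>R y)" "T x"] by simp
    then have "norm (T y) \<le> (real n + real n) / t" using t by (simp add: field_simps)
    then show ?thesis by (simp add: t_def K_def algebra_simps)
  qed (simp add: linear_0[OF lin])
  moreover have "0 \<le> K" using r by (simp add: K_def)
  ultimately show ?thesis using that by blast
qed

text \<open>Conjugation by \<open>a\<close> is absorbed into the vector, so a norm inequality valid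
  at all vectors supplies the hypothesis of \<open>npos_diff_if_norm_le\<close>.\<close>

lemma conj_form:
  assumes "R \<in> adjointable ip"
  shows "star a * ip x (R x) * a = ip (act x a) (R (act x a))"
  by (simp add: adjointable_linear[OF assms] ip_act_left ip_act_right mult.assoc)

lemma conj_ip: "star a * ip x x * a = ip (act x a) (act x a)"
  by (simp add: ip_act_left ip_act_right mult.assoc)

section \<open>Positive spectrum and positive forms\<close>

text \<open>The form of \<open>R = P + s\<close> is positive for large \<open>s\<close>. If it is positive and \<open>R\<close> has an inverse \<open>S\<close>,
  then Cauchy-Schwarz for this form at \<open>x\<close> and \<open>S x\<close> shows \<open>\<langle>x, R x\<rangle> \<ge> \<langle>x, x\<rangle> / norm S\<close>, so \<open>s\<close> can be
  lowered as long as it is positive.\<close>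

lemma npos_form_if_op_positive:
  assumes "op_positive ip P" shows "npos (ip x (P x))"
proof -
  have P: "P \<in> adjointable ip" and adjP: "adj ip P = P" and spec: "op_spectrum ip P \<subseteq> \<real>\<^sub>\<ge>\<^sub>0"
    using assms by (auto simp: op_positive_def)
  have sa: "ip (P x) y = ip x (P y)" for x y using ip_adj[OF P] adjP by simp
  then have sx: "star (ip x (P x)) = ip x (P x)" for x by (simp add: ip_star)
  have "\<forall>x. npos (ip x (P x) + 0 *\<^sub>R ip x x)"
  proof -
    obtain K where K: "0 \<le> K" "\<And>x. norm (P x) \<le> K * norm x" using adjointable_bounded[OF P] by blast
    show ?thesis
    proof (rule upward_closed_zero[where G = "\<lambda>s. \<forall>x. npos (ip x (P x) + s *\<^sub>R ip x x)" and t = K])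
      have "npos (K *\<^sub>R ip x x - (- ip x (P x)))" for x
      proof (rule npos_diff_if_norm_le)
        fix a
        let ?y = "act x a"
        have "norm (ip ?y (P ?y)) \<le> K * (norm ?y)\<^sup>2"
          using norm_ip_le[of ?y "P ?y"] mult_left_mono[OF K(2)[of ?y], of "norm ?y"]
          by (simp add: power2_eq_square algebra_simps)
        then have "norm (star a * ip x (P x) * a) \<le> K * norm (star a * ip x x * a)"
          unfolding conj_form[OF P] conj_ip norm_ip_self .
        then show "norm (star a * - ip x (P x) * a) \<le> norm (star a * K *\<^sub>R ip x x * a)"
          using K(1) by simp
      qed (use K sx in \<open>simp_all add: star_simps npos_scaleR npos_ip\<close>)
      then show "\<forall>x. npos (ip x (P x) + K *\<^sub>R ip x x)" by (simp add: add.commute)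
      show "\<forall>x. npos (ip x (P x) + s *\<^sub>R ip x x)"
        if "\<And>e. 0 < e \<Longrightarrow> \<forall>x. npos (ip x (P x) + (s + e) *\<^sub>R ip x x)" for s
      proof (rule allI, rule npos_limit)
        fix x show "star (ip x x) = ip x x" by (rule ip_star)
        show "npos (ip x (P x) + s *\<^sub>R ip x x + e *\<^sub>R ip x x)" if "0 < e" for e
          using \<open>\<And>e. 0 < e \<Longrightarrow> \<forall>x. npos (ip x (P x) + (s + e) *\<^sub>R ip x x)\<close>[OF that]
          by (simp only: scaleR_left_distrib add.assoc)
      qed
      show "\<forall>x. npos (ip x (P x) + (s + e) *\<^sub>R ip x x)"
        if "\<forall>x. npos (ip x (P x) + s *\<^sub>R ip x x)" "0 \<le> e" for s e
        using npos_add[OF that(1)[rule_format] npos_scaleR[OF npos_ip that(2)]]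
        by (simp only: scaleR_left_distrib add.assoc simp_thms)
      fix s :: real assume s: "0 < s" and G: "\<forall>x. npos (ip x (P x) + s *\<^sub>R ip x x)"
      define R where "R x = P x + s *\<^sub>R x" for x
      have Rsa: "ip (R x) y = ip x (R y)" for x y
        by (simp add: R_def ip_add_left ip_add_right ip_scaleR_left ip_scaleR_right sa)
      note R = adjointableI[OF Rsa]
      have ipR: "ip x (R x) = ip x (P x) + s *\<^sub>R ip x x" for x
        by (simp add: R_def ip_add_right ip_scaleR_right)
      have "complex_of_real (- s) \<notin> op_spectrum ip P"
        using s spec by (auto simp: complex_nonneg_Reals_iff)
      moreover have "P x - complex_of_real (- s) *\<^sub>C x = R x" for x
        unfolding R_def by (metis diff_minus_eq_add scaleR_minus_left scaleR_scaleC)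
      ultimately obtain S where S: "S \<in> adjointable ip" "R \<circ> S = id"
        unfolding op_spectrum_def by auto
      have RS: "R (S x) = x" for x using S(2) by (metis comp_apply id_apply)
      obtain N where N: "0 \<le> N" "\<And>x. norm (S x) \<le> N * norm x"
        using adjointable_bounded[OF S(1)] by blast
      define M where "M = N + 1"
      have M: "0 < M" using N by (simp add: M_def)
      have SM: "norm (S x) \<le> M * norm x" for x
        using N(2)[of x] by (simp add: M_def distrib_right) (metis add_increasing2 norm_ge_zero)
      have lower: "(norm x)\<^sup>2 \<le> M * norm (ip x (R x))" for x
      proof (cases "x = 0")
        case False
        \<comment> \<open>Since \<open>R (S x) = x\<close>, the mixed term of the form at
          \<open>x\<close> and \<open>S x\<close> is \<open>ip x x\<close>.\<close>
        have "((norm x)\<^sup>2)\<^sup>2 \<le> norm (ip x (R x)) * norm (ip (S x) x)"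
          using form_Cauchy_Schwarz[OF Rsa, of x "S x"] G by (simp add: ipR RS norm_ip_self flip: ipR)
        also have "\<dots> \<le> norm (ip x (R x)) * (M * norm x * norm x)"
          using SM[of x] by (intro mult_left_mono order.trans[OF norm_ip_le] mult_right_mono) auto
        finally have "(norm x)\<^sup>2 * (norm x)\<^sup>2 \<le> M * norm (ip x (R x)) * (norm x)\<^sup>2"
          by (simp add: power2_eq_square algebra_simps)
        moreover have "0 < (norm x)\<^sup>2" using False by simp
        ultimately show ?thesis by (rule mult_right_le_imp_le)
      qed (use M in simp)
      have "npos (M *\<^sub>R ip x (R x) - ip x x)" for x
      proof (rule npos_diff_if_norm_le)
        fix a
        have "norm (star a * ip x x * a) \<le> M * norm (star a * ip x (R x) * a)"
          unfolding conj_form[OF R] conj_ip norm_ip_self by (rule lower)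
        then show "norm (star a * ip x x * a) \<le> norm (star a * M *\<^sub>R ip x (R x) * a)"
          using M by simp
      qed (use M G in \<open>simp_all add: ip_star npos_scaleR ipR\<close>)
      then have "npos ((1/M) *\<^sub>R (M *\<^sub>R ip x (R x) - ip x x))" for x
        using M by (intro npos_scaleR) auto
      moreover have "(1/M) *\<^sub>R (M *\<^sub>R ip x (R x) - ip x x) = ip x (P x) + (s - 1/M) *\<^sub>R ip x x" for x
        using M by (simp add: ipR scaleR_right_diff_distrib scaleR_left_diff_distrib)
      ultimately show "\<exists>s'<s. \<forall>x. npos (ip x (P x) + s' *\<^sub>R ip x x)"
        using M by (intro exI[of _ "s - 1/M"]) auto
    qed
  qed
  then show ?thesis by simp
qed

text \<open>The lower bound makes the right inverse \<open>g\<close> of \<open>B\<close> Lipschitz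
  with constant \<open>1 / m\<close>, so a solution is the fixed point of the contraction
  \<open>x \<mapsto> g (y - d x)\<close>.\<close>

lemma surj_perturb:
  fixes B :: "'e \<Rightarrow> 'e"
  assumes diff: "\<And>x y. B (x - y) = B x - B y" and surj: "surj B"
    and lower: "\<And>x. m * norm x \<le> norm (B x)" and d: "cmod d < m"
  shows "surj (\<lambda>x. B x + d *\<^sub>C x)"
  unfolding surj_def
proof
  fix y
  have m: "0 < m" using d norm_ge_zero le_less_trans by blast
  define g where "g = inv B"
  have Bg: "B (g u) = u" for u unfolding g_def by (rule surj_f_inv_f[OF surj])
  have g: "norm (g u - g v) \<le> norm (u - v) / m" for u v
    using lower[of "g u - g v"] m by (simp add: diff Bg pos_le_divide_eq mult.commute)
  have "\<exists>!x. g (y - d *\<^sub>C x) = x"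
  proof (rule banach_fix_type[of "cmod d / m"], goal_cases)
    case 3
    have "norm (g (y - d *\<^sub>C u) - g (y - d *\<^sub>C v)) \<le> cmod d * norm (u - v) / m" for u v
    proof -
      have "(y - d *\<^sub>C u) - (y - d *\<^sub>C v) = d *\<^sub>C (v - u)" by (simp add: scaleC_diff_right)
      then show ?thesis using g[of "y - d *\<^sub>C u" "y - d *\<^sub>C v"]
        by (simp add: norm_scaleC norm_minus_commute)
    qed
    then show ?case by (simp add: dist_norm)
  qed (use m d in simp_all)
  then obtain x where "g (y - d *\<^sub>C x) = x" by blast
  then have "y = B x + d *\<^sub>C x" by (metis Bg diff_add_cancel)
  then show "\<exists>x. y = B x + d *\<^sub>C x" ..
qed

text \<open>Continuation along the ray through \<open>c\<close>: a lower bound for \<open>P - t c\<close> proportional to \<open>t\<close> lets one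
  pass from large \<open>t\<close>, where \<open>P - t c\<close> is onto, down to \<open>t = 1\<close> in finitely many steps.\<close>

lemma surj_if_lower_bound:
  assumes P: "P \<in> adjointable ip" and c: "c \<noteq> 0" and \<kappa>: "0 < \<kappa>"
    and lower: "\<And>t x. 0 < t \<Longrightarrow> t * \<kappa> * norm x \<le> norm (P x - (of_real t * c) *\<^sub>C x)"
  shows "surj (\<lambda>x. P x - c *\<^sub>C x)"
proof -
  obtain K where K: "0 \<le> K" "\<And>x. norm (P x) \<le> K * norm x" using adjointable_bounded[OF P] by blast
  note Pdiff = linear_diff[OF adjointable_linear_map[OF P]]
  \<comment> \<open>Going from \<open>t\<close> to \<open>(1 - \<theta>) t\<close> perturbs by
    \<open>t \<theta> c\<close>, which must stay below the lower bound \<open>t \<kappa>\<close>.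
    The same ratio works for every \<open>t\<close>, so \<open>n\<close> steps lead from
    \<open>q ^ n\<close> to 1.\<close>
  define \<theta> where "\<theta> = min (1/2) (\<kappa> / (2 * cmod c))"
  have \<theta>: "0 < \<theta>" "\<theta> < 1" using \<kappa> c by (simp_all add: \<theta>_def)
  have "\<theta> * cmod c \<le> \<kappa> / (2 * cmod c) * cmod c" by (intro mult_right_mono) (simp_all add: \<theta>_def)
  then have \<theta>c: "\<theta> * cmod c < \<kappa>" using \<kappa> c by simp
  define q where "q = 1 / (1 - \<theta>)"
  have q: "1 < q" using \<theta> by (simp add: q_def)
  let ?B = "\<lambda>t x. P x - (of_real t * c) *\<^sub>C x"
  have step: "surj (?B ((1 - \<theta>) * t))" if "surj (?B t)" "0 < t" for t
  proof -
    have surj: "surj (\<lambda>x. ?B t x + (of_real (t * \<theta>) * c) *\<^sub>C x)"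
    proof (rule surj_perturb[where m = "t * \<kappa>"])
      show "cmod (of_real (t * \<theta>) * c) < t * \<kappa>"
        using \<theta>c \<theta> \<open>0 < t\<close> by (simp add: norm_mult mult.assoc)
    qed (use that lower in \<open>simp_all add: Pdiff scaleC_diff_right\<close>)
    have "of_real ((1 - \<theta>) * t) * c = of_real t * c - of_real (t * \<theta>) * c"
      by (simp add: algebra_simps)
    then have "?B t x + (of_real (t * \<theta>) * c) *\<^sub>C x = ?B ((1 - \<theta>) * t) x" for x
      by (simp only: scaleC_diff_left diff_diff_eq2 diff_add_eq)
    with surj show ?thesis by (simp only:)
  qed
  have descent: "surj (?B (q ^ n)) \<Longrightarrow> surj (?B 1)" for n
  proof (induction n)
    case (Suc n)
    have "(1 - \<theta>) * q ^ Suc n = q ^ n" using \<theta> by (simp add: q_def)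
    moreover have "0 < q ^ Suc n" using q by (intro zero_less_power) simp
    ultimately show ?case using step[OF Suc.prems] Suc.IH by (simp only:)
  qed simp
  \<comment> \<open>For \<open>cmod w > K\<close> the map \<open>x \<mapsto> (P x - y) / w\<close>
    is a contraction, whose fixed point solves \<open>P x - w x = y\<close>.\<close>
  obtain n where n: "K / cmod c < q ^ n" using real_arch_pow[OF q] by blast
  define w where "w = of_real (q ^ n) * c"
  have "cmod w = q ^ n * cmod c" using q by (simp add: w_def norm_mult norm_power)
  then have w: "K < cmod w" using n c by (simp add: field_simps)
  have w0: "0 < cmod w" using w K(1) by linarith
  have "surj (?B (q ^ n))"
    unfolding surj_def
  proof
    fix y
    have "\<exists>!x. (1 / w) *\<^sub>C (P x - y) = x"
    proof (rule banach_fix_type[of "K / cmod w"], goal_cases)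
      case 3
      have "norm ((1 / w) *\<^sub>C (P u - y) - (1 / w) *\<^sub>C (P v - y)) \<le> K / cmod w * norm (u - v)" for u v
        using K(2)[of "u - v"] w K(1)
        by (simp add: norm_scaleC norm_divide divide_right_mono Pdiff flip: scaleC_diff_right)
      then show ?case by (simp add: dist_norm)
    qed (use w w0 K in \<open>simp_all add: pos_divide_less_eq del: zero_less_norm_iff\<close>)
    then obtain x where x: "(1 / w) *\<^sub>C (P x - y) = x" by blast
    have "w \<noteq> 0" using w0 by auto
    then have "w *\<^sub>C x = P x - y" by (subst x[symmetric]) (simp add: scaleC_scaleC)
    then show "\<exists>x. y = ?B (q ^ n) x" unfolding w_def[symmetric] by (metis diff_diff_eq2 add_diff_cancel_left')
  qed
  then show ?thesis using descent by simp
qed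

text \<open>For negative real \<open>c\<close> the form of \<open>P - t c\<close> dominates
  \<open>t \<bar>c\<bar> \<langle>x, x\<rangle>\<close>. For nonreal \<open>c\<close> its imaginary
  part is a multiple of \<open>\<langle>x, x\<rangle>\<close>. Cauchy-Schwarz passes from the form
  to the norm.\<close>

lemma lower_bound_if_npos_form:
  assumes P: "P \<in> adjointable ip" and pos: "\<And>x. npos (ip x (P x))" and c: "c \<notin> \<real>\<^sub>\<ge>\<^sub>0"
  obtains \<kappa> where "0 < \<kappa>"
    "\<And>t x. 0 < t \<Longrightarrow> t * \<kappa> * norm x \<le> norm (P x - (of_real t * c) *\<^sub>C x)"
proof -
  have key: "\<exists>\<kappa>>0. \<forall>t>0. \<forall>x. t * \<kappa> * (norm x)\<^sup>2 \<le> norm (ip x (P x - (of_real t * c) *\<^sub>C x))"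
  proof (cases "Im c = 0")
    case True
    then have "Re c < 0" "c = of_real (Re c)" using c by (auto simp: complex_nonneg_Reals_iff complex_eq_iff)
    have "t * (- Re c) * (norm x)\<^sup>2 \<le> norm (ip x (P x - (of_real t * c) *\<^sub>C x))" if "0 < t" for t x
    proof -
      have "(of_real t * c) *\<^sub>C ip x x = (t * Re c) *\<^sub>R ip x x"
        using \<open>c = of_real (Re c)\<close> by (metis of_real_mult scaleR_scaleC)
      then have "ip x (P x - (of_real t * c) *\<^sub>C x) = (t * (- Re c)) *\<^sub>R ip x x + ip x (P x)"
        by (simp add: ip_diff_right ip_scaleC_right)
      then show ?thesis
        using norm_mono_npos[OF npos_scaleR[OF npos_ip] pos, of "t * (- Re c)" x x] that \<open>Re c < 0\<close>
        by (simp add: norm_ip_self abs_mult mult_le_0_iff)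
    qed
    then show ?thesis using \<open>Re c < 0\<close> by (intro exI[of _ "- Re c"]) simp
  next
    case False
    have "t * \<bar>Im c\<bar> * (norm x)\<^sup>2 \<le> norm (ip x (P x - (of_real t * c) *\<^sub>C x))" if "0 < t" for t x
    proof -
      define v where "v = ip x (P x - (of_real t * c) *\<^sub>C x)"
      have v: "v = ip x (P x) - (of_real t * c) *\<^sub>C ip x x"
        by (simp add: v_def ip_diff_right ip_scaleC_right)
      have "star v - v = (of_real t * c - of_real t * cnj c) *\<^sub>C ip x x"
        unfolding v using npos_self_adjoint[OF pos] by (simp add: star_simps ip_star scaleC_diff_left)
      also have "of_real t * c - of_real t * cnj c = of_real (2 * t * Im c) * \<i>"
        by (simp add: complex_eq_iff)
      finally have "2 * (t * \<bar>Im c\<bar> * (norm x)\<^sup>2) = norm (star v - v)"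
        using that by (simp add: norm_scaleC norm_mult norm_ip_self abs_mult)
      also have "\<dots> \<le> 2 * norm v" using norm_triangle_ineq4[of "star v" v] by simp
      finally show ?thesis by (simp add: v_def)
    qed
    then show ?thesis using False by (intro exI[of _ "\<bar>Im c\<bar>"]) simp
  qed
  then obtain \<kappa> where \<kappa>: "0 < \<kappa>"
    "\<And>t x. 0 < t \<Longrightarrow> t * \<kappa> * (norm x)\<^sup>2 \<le> norm (ip x (P x - (of_real t * c) *\<^sub>C x))" by blast
  have "t * \<kappa> * norm x \<le> norm (P x - (of_real t * c) *\<^sub>C x)" if "0 < t" for t x
  proof (cases "x = 0")
    case False
    have "(t * \<kappa> * norm x) * norm x \<le> norm (P x - (of_real t * c) *\<^sub>C x) * norm x"
      using order.trans[OF \<kappa>(2)[OF that] norm_ip_le] by (simp add: power2_eq_square mult.commute mult.left_commute)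
    with False show ?thesis by simp
  qed simp
  with \<kappa>(1) that show ?thesis by blast
qed

lemma op_spectrum_nonneg_if_npos_form:
  assumes sa: "\<And>x y. ip (P x) y = ip x (P y)" and pos: "\<And>x. npos (ip x (P x))"
  shows "op_spectrum ip P \<subseteq> \<real>\<^sub>\<ge>\<^sub>0"
proof (rule subsetI, rule ccontr)
  fix c assume c: "c \<in> op_spectrum ip P" "c \<notin> \<real>\<^sub>\<ge>\<^sub>0"
  note P = adjointableI[OF sa]
  have bij: "bij (\<lambda>x. P x - c *\<^sub>C x)" if c: "c \<notin> \<real>\<^sub>\<ge>\<^sub>0" for c
  proof -
    obtain \<kappa> where \<kappa>: "0 < \<kappa>"
      "\<And>t x. 0 < t \<Longrightarrow> t * \<kappa> * norm x \<le> norm (P x - (of_real t * c) *\<^sub>C x)"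
      using lower_bound_if_npos_form[OF P pos c] by blast
    have "inj (\<lambda>x. P x - c *\<^sub>C x)"
    proof (rule injI)
      fix x y assume "P x - c *\<^sub>C x = P y - c *\<^sub>C y"
      then have "P (x - y) - c *\<^sub>C (x - y) = 0"
        by (simp add: linear_diff[OF adjointable_linear_map[OF P]] scaleC_diff_right algebra_simps)
      then have "\<kappa> * norm (x - y) \<le> 0" using \<kappa>(2)[of 1 "x - y"] by simp
      then show "x = y" using \<kappa>(1) by (simp add: mult_le_0_iff)
    qed
    moreover have "c \<noteq> 0" using c by auto
    ultimately show ?thesis using surj_if_lower_bound[OF P _ \<kappa>] by (simp add: bij_def)
  qed
  define R where "R = (\<lambda>x. P x - c *\<^sub>C x)"
  \<comment> \<open>The adjoint of \<open>R\<close>; its inverse is the adjoint of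
    \<open>inv R\<close>, which shows that \<open>inv R\<close> is adjointable.\<close>
  define R' where "R' = (\<lambda>x. P x - cnj c *\<^sub>C x)"
  have "cnj c \<notin> \<real>\<^sub>\<ge>\<^sub>0" using c(2) by (simp add: complex_nonneg_Reals_iff)
  then have b: "bij R" "bij R'" using c(2) bij by (simp_all add: R_def R'_def)
  have RR': "ip (R x) y = ip x (R' y)" for x y
    by (simp add: R_def R'_def ip_diff_left ip_diff_right ip_scaleC_left ip_scaleC_right sa)
  have "inv R \<in> adjointable ip"
  proof (rule adjointableI[where S = "inv R'"])
    fix x y
    have "ip (inv R x) (R' (inv R' y)) = ip (R (inv R x)) (inv R' y)" by (simp add: RR')
    then show "ip (inv R x) y = ip x (inv R' y)"
      using b by (simp add: bij_is_surj surj_f_inv_f)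
  qed
  moreover have "R \<circ> inv R = id" "inv R \<circ> R = id"
    using b by (simp_all add: bij_is_surj bij_is_inj flip: surj_iff)
  ultimately show False using c(1) unfolding op_spectrum_def R_def by blast
qed

lemma op_positive_iff_npos_form:
  assumes sa: "\<And>x y. ip (P x) y = ip x (P y)"
  shows "op_positive ip P \<longleftrightarrow> (\<forall>x. npos (ip x (P x)))"
  using npos_form_if_op_positive op_spectrum_nonneg_if_npos_form[OF sa] adjointableI[OF sa]
    adj_eqI[OF sa] by (auto simp: op_positive_def)

section \<open>Comparison of operators and hyponormality\<close>

lemma op_le_iff_norm_le:
  assumes T: "\<And>x y. ip (T x) y = ip x (T' y)" and S: "\<And>x y. ip (S x) y = ip x (S' y)"
  shows "op_le ip (S' \<circ> S) (T' \<circ> T) \<longleftrightarrow> (\<forall>x. norm (S x) \<le> norm (T x))"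
proof -
  have T': "ip (T' x) y = ip x (T y)" and S': "ip (S' x) y = ip x (S y)" for x y
    using T S by (metis ip_star)+
  have adj: "S' \<circ> S \<in> adjointable ip" "T' \<circ> T \<in> adjointable ip"
    by (rule adjointableI, simp add: T T' S S')+
  define P where "P x = (T' \<circ> T) x - (S' \<circ> S) x" for x
  have sa: "ip (P x) y = ip x (P y)" for x y
    by (simp add: P_def ip_diff_left ip_diff_right T T' S S')
  have form: "ip x (P x) = ip (T x) (T x) - ip (S x) (S x)" for x
    by (simp add: P_def ip_diff_right T S)
  have "(\<forall>x. npos (ip x (P x))) \<longleftrightarrow> (\<forall>x. norm (S x) \<le> norm (T x))"
  proof (intro iffI allI)
    fix x assume "\<forall>x. npos (ip x (P x))"
    then have "norm (ip (S x) (S x)) \<le> norm (ip (T x) (T x))"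
      using norm_mono_npos[OF npos_ip[of "S x"], of "ip x (P x)"] by (simp add: form)
    then show "norm (S x) \<le> norm (T x)" by (simp add: norm_eq_ip)
  next
    fix x assume le: "\<forall>x. norm (S x) \<le> norm (T x)"
    show "npos (ip x (P x))" unfolding form
    proof (rule npos_diff_if_norm_le)
      fix a
      have "norm (ip (S (act x a)) (S (act x a))) \<le> norm (ip (T (act x a)) (T (act x a)))"
        using le by (simp add: norm_ip_self power_mono)
      then show "norm (star a * ip (S x) (S x) * a) \<le> norm (star a * ip (T x) (T x) * a)"
        unfolding conj_ip by (simp add: adjointable_linear[OF adjointableI[OF S]]
            adjointable_linear[OF adjointableI[OF T]])
    qed (simp_all add: ip_star npos_ip)
  qed
  then show ?thesis
    using op_positive_iff_npos_form[OF sa] adj by (simp add: op_le_def P_def)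
qed

text \<open>Moving \<open>C\<close> across the inner product costs one \<open>sharp\<close>; moving
  it twice costs none, so \<open>C T C\<close> is the adjoint of \<open>C T\<^sup>* C\<close>. The
  outer \<open>C\<close> drops out of the norm because \<open>C\<close> is isometric.\<close>

lemma C_hyponormal_iff_norm_le:
  assumes sharp: "star_conjugate_automorphism sharp" and C: "sharp_conjugation ip sharp C"
    and T: "T \<in> adjointable ip"
  shows "C_hyponormal ip C T \<longleftrightarrow> (\<forall>x. norm (adj ip T (C x)) \<le> norm (T x))"
proof -
  have CC: "C (C x) = x" and ipC: "ip (C x) (C y) = sharp (ip x y)" for x y
    using C by (auto simp: sharp_conjugation_def fun_eq_iff)
  have ss: "sharp (sharp a) = a" for a using sharp by (simp add: star_conjugate_automorphism_def)
  have normC: "norm (C x) = norm x" for x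
    using norm_star_conjugate_automorphism[OF sharp ip_star[of x x]] by (simp add: norm_eq_ip ipC)
  have ipC': "ip (C x) y = sharp (ip x (C y))" for x y
    using ipC[of x "C y"] by (simp add: CC)
  have adj: "ip (adj ip T x) y = ip x (T y)" for x y
    using ip_adj[OF T] by (metis ip_star)
  define S where "S = C \<circ> adj ip T \<circ> C"
  define S' where "S' = C \<circ> T \<circ> C"
  have "ip (S x) y = ip x (S' y)" for x y
    by (simp add: S_def S'_def ipC' adj ss)
  then have "op_le ip (S' \<circ> S) (adj ip T \<circ> T) \<longleftrightarrow> (\<forall>x. norm (S x) \<le> norm (T x))"
    by (intro op_le_iff_norm_le ip_adj T)
  moreover have "S' \<circ> S = C \<circ> T \<circ> adj ip T \<circ> C" by (simp add: S_def S'_def fun_eq_iff CC)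
  ultimately show ?thesis by (simp add: C_hyponormal_def S_def normC)
qed

end

theorem corollary4p6:
  fixes act :: "'e::complex_banach \<Rightarrow> 'a::unital_cstar_algebra \<Rightarrow> 'e"
    and ip :: "'e \<Rightarrow> 'e \<Rightarrow> 'a"
    and sharp :: "'a \<Rightarrow> 'a"
    and C T :: "'e \<Rightarrow> 'e"
  assumes "star_conjugate_automorphism sharp"
    and "hilbert_cstar_module act ip"
    and "sharp_conjugation ip sharp C"
    and "T \<in> adjointable ip"
    and "orthogonally_complemented ip (closure (range T))"
  shows "C_hyponormal ip C T \<longleftrightarrow> (\<forall>x. norm (T x) \<ge> norm (adj ip T (C x)))"
  using hilbert_cstar_module.C_hyponormal_iff_norm_le assms(1-4) by blast

end
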